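(* For every $\rho>0$ (with $\rho\le1$) there exists $c<\infty$ such that for every positive integer $k$, $$\mathsf{PSR\text{-}CC}(k)\subseteq \mathsf{ISR\text{-}CC}^{\mathrm{one\text{-}way}}_\rho(c^k),$$ i.e. every promise problem that has a (two-way) communication protocol with perfectly shared randomness of cost at most $k$ has a one-way protocol with $\rho$-correlated randomness of cost at most $c^k$.
   Context: A promise problem $P=(P_n)_n$ consists, for each $n$, of disjoint sets $P_n^{\mathrm{yes}},P_n^{\mathrm{no}}\subseteq\{0,1\}^n\times\{0,1\}^n$; Alice gets $x$, Bob gets $y$, and they must decide whether $(x,y)$ is a yes- or no-instance (behaviour on other inputs is irrelevant). A randomized protocol solves $P$ if on every yes- or no-instance its output is correct with probability at least $2/3$. The cost of a protocol is the maximum over inputs of the expected number of bits communicated. Imperfectly shared randomness: for $\rho\in[0,1]$, a pair of bits $(a,b)\in\{+1,-1\}^2$ is $\rho$-correlated if $\mathbb E[a]=\mathbb E[b]=0$ and $\mathbb E[ab]=\rho$. Alice receives an arbitrarily long sequence $r$ and Bob a sequence $r'$, where the pairs $(r_i,r'_i)$ are independent $\rho$-correlated pairs. $\mathrm{ISR}_\rho(P)$ is the minimum cost of a protocol solving $P$ with access to $\rho$-correlated bits; $\mathrm{ISR}^{\mathrm{one\text{-}way}}_\rho(P)$ is the same for one-way protocols (Alice sends one message, Bob outputs). $\mathrm{PSR}(P)=\mathrm{ISR}_1(P)$ (perfectly shared randomness). $\mathsf{PSR\text{-}CC}(k)$ is the class of promise problems $P$ with $\mathrm{PSR}(P)\le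 k$, and $\mathsf{ISR\text{-}CC}^{\mathrm{one\text{-}way}}_\rho(k)$ the class of those with $\mathrm{ISR}^{\mathrm{one\text{-}way}}_\rho(P)\le k$. *)

theory Defs
  imports "HOL-Probability.Probability"
begin

section \<open>Promise problems\<close>

record promise_problem =
  yes_inst :: "nat \<Rightarrow> (bool list \<times> bool list) set"
  no_inst :: "nat \<Rightarrow> (bool list \<times> bool list) set"

definition cube :: "nat \<Rightarrow> bool list set" where
  "cube n = {x. length x = n}"

definition is_promise_problem :: "promise_problem \<Rightarrow> bool" where
  "is_promise_problem P \<longleftrightarrow>
     (\<forall>n. yes_inst P n \<subseteq> cube n \<times> cube n \<and> no_inst P n \<subseteq> cube n \<times> cube n \<and>
          yes_inst P n \<inter> no_inst P n = {})"


section \<open>Correlated randomness\<close>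

text \<open>Random bits are booleans: \<^term>\<open>True\<close> stands for \<open>+1\<close> and \<^term>\<open>False\<close> for \<open>-1\<close>.\<close>

definition pm :: "bool \<Rightarrow> real" where
  "pm b = (if b then 1 else - 1)"

definition correlated :: "real \<Rightarrow> (bool \<times> bool) pmf \<Rightarrow> bool" where
  "correlated \<rho> p \<longleftrightarrow>
     measure_pmf.expectation p (\<lambda>(a, b). pm a) = 0 \<and>
     measure_pmf.expectation p (\<lambda>(a, b). pm b) = 0 \<and>
     measure_pmf.expectation p (\<lambda>(a, b). pm a * pm b) = \<rho>"

text \<open>The three moment conditions determine the distribution; see \<open>correlated_ex1\<close> below.\<close>

definition corr_pair :: "real \<Rightarrow> (bool \<times> bool) pmf" where
  "corr_pair \<rho> = (THE p. correlated \<rho> p)"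

lemma expectation_bool_pair:
  fixes f :: "bool \<times> bool \<Rightarrow> real"
  shows "measure_pmf.expectation p f =
    pmf p (True, True) * f (True, True) + pmf p (True, False) * f (True, False) +
    pmf p (False, True) * f (False, True) + pmf p (False, False) * f (False, False)"
  by (subst integral_measure_pmf_real[where A = UNIV])
     (auto simp: UNIV_bool UNIV_Times_UNIV[symmetric] simp del: UNIV_Times_UNIV)

lemma sum_pmf_bool_pair:
  "pmf p (True, True) + pmf p (True, False) + pmf p (False, True) + pmf p (False, False) = 1"
  using expectation_bool_pair[of p "\<lambda>_. 1"] by simp

lemma correlated_iff:
  "correlated \<rho> p \<longleftrightarrow> (\<forall>a b. pmf p (a, b) = (1 + \<rho> * pm a * pm b) / 4)"
  using sum_pmf_bool_pair[of p]
  by (auto simp: correlated_def expectation_bool_pair all_bool_eq pm_def field_simps)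

lemma correlated_ex1:
  assumes "0 \<le> \<rho>" "\<rho> \<le> 1"
  shows "\<exists>!p. correlated \<rho> p"
proof -
  define f where "f = (\<lambda>(a, b). (1 + \<rho> * pm a * pm b) / 4)"
  have nonneg: "f z \<ge> 0" for z
    using assms by (auto simp: f_def pm_def split: prod.split)
  have "(\<integral>\<^sup>+z. ennreal (f z) \<partial>count_space UNIV) = (\<Sum>z\<in>UNIV. ennreal (f z))"
    by (rule nn_integral_count_space_finite) simp
  also have "\<dots> = ennreal (\<Sum>z\<in>UNIV. f z)"
    using nonneg by (simp add: sum_ennreal)
  also have "(\<Sum>z\<in>UNIV. f z) = 1"
    by (auto simp: field_simps f_def pm_def UNIV_bool UNIV_Times_UNIV[symmetric] simp del: UNIV_Times_UNIV)
  finally have "pmf (embed_pmf f) z = f z" for z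
    using nonneg by (intro pmf_embed_pmf) auto
  then have ex: "correlated \<rho> (embed_pmf f)"
    by (simp add: correlated_iff f_def)
  show ?thesis
  proof (rule ex1I[where a = "embed_pmf f"], fact ex)
    fix q assume "correlated \<rho> q"
    with ex have "pmf q (a, b) = pmf (embed_pmf f) (a, b)" for a b
      unfolding correlated_iff by presburger
    then show "q = embed_pmf f"
      by (intro pmf_eqI) auto
  qed
qed

lemma correlated_corr_pair:
  assumes "0 \<le> \<rho>" "\<rho> \<le> 1"
  shows "correlated \<rho> (corr_pair \<rho>)"
  unfolding corr_pair_def by (rule theI'[OF correlated_ex1[OF assms]])

lemma pmf_corr_pair:
  assumes "0 \<le> \<rho>" "\<rho> \<le> 1"
  shows "pmf (corr_pair \<rho>) (a, b) = (1 + \<rho> * pm a * pm b) / 4"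
  using correlated_corr_pair[OF assms] by (simp add: correlated_iff)

text \<open>An infinite i.i.d. sequence of pairs: in \<open>\<omega>\<close>, Alice sees \<^term>\<open>fst \<circ> \<omega>\<close> and Bob
  \<^term>\<open>snd \<circ> \<omega>\<close>.\<close>

definition corr_space :: "real \<Rightarrow> (nat \<Rightarrow> bool \<times> bool) measure" where
  "corr_space \<rho> = PiM UNIV (\<lambda>_. measure_pmf (corr_pair \<rho>))"

lemma prob_space_corr_space: "prob_space (corr_space \<rho>)"
  unfolding corr_space_def by (intro prob_space_PiM measure_pmf.prob_space_axioms)

definition bit_seq_space :: "(nat \<Rightarrow> bool) measure" where
  "bit_seq_space = PiM UNIV (\<lambda>_. count_space UNIV)"


section \<open>Protocols\<close>

datatype party = Alice | Bob

datatype action = Send party | Answer party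

text \<open>The transcript so far alone determines who acts next and whether the protocol is over, so
  the end of the communication is never signalled for free. The acting party computes one bit
  from its own input, its own random sequence and the transcript; this bit is appended to the
  transcript (\<^const>\<open>Send\<close>) or is the output (\<^const>\<open>Answer\<close>). Runs may be infinite.\<close>

record protocol =
  act :: "bool list \<Rightarrow> action"
  alice :: "bool list \<Rightarrow> (nat \<Rightarrow> bool) \<Rightarrow> bool list \<Rightarrow> bool"
  bob :: "bool list \<Rightarrow> (nat \<Rightarrow> bool) \<Rightarrow> bool list \<Rightarrow> bool"

definition measurable_protocol :: "protocol \<Rightarrow> bool" where
  "measurable_protocol \<pi> \<longleftrightarrow>
     (\<forall>x t. (\<lambda>r. alice \<pi> x r t) \<in> measurable bit_seq_space (count_space UNIV)) \<and>
     (\<forall>y t. (\<lambda>r. bob \<pi> y r t) \<in> measurable bit_seq_space (count_space UNIV))"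

definition one_way :: "protocol \<Rightarrow> bool" where
  "one_way \<pi> \<longleftrightarrow> (\<forall>t. act \<pi> t = Send Alice \<or> act \<pi> t = Answer Bob)"

fun party_bit :: "protocol \<Rightarrow> bool list \<Rightarrow> bool list \<Rightarrow> (nat \<Rightarrow> bool \<times> bool) \<Rightarrow>
    party \<Rightarrow> bool list \<Rightarrow> bool" where
  "party_bit \<pi> x y \<omega> Alice t = alice \<pi> x (fst \<circ> \<omega>) t"
| "party_bit \<pi> x y \<omega> Bob t = bob \<pi> y (snd \<circ> \<omega>) t"

primrec transcript :: "protocol \<Rightarrow> bool list \<Rightarrow> bool list \<Rightarrow> (nat \<Rightarrow> bool \<times> bool) \<Rightarrow>
    nat \<Rightarrow> bool list" where
  "transcript \<pi> x y \<omega> 0 = []"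
| "transcript \<pi> x y \<omega> (Suc j) =
     (let t = transcript \<pi> x y \<omega> j in
      case act \<pi> t of Send p \<Rightarrow> t @ [party_bit \<pi> x y \<omega> p t] | Answer p \<Rightarrow> t)"

definition bits_sent :: "protocol \<Rightarrow> bool list \<Rightarrow> bool list \<Rightarrow> (nat \<Rightarrow> bool \<times> bool) \<Rightarrow> ennreal" where
  "bits_sent \<pi> x y \<omega> = (SUP j. of_nat (length (transcript \<pi> x y \<omega> j)))"

definition outputs :: "protocol \<Rightarrow> bool list \<Rightarrow> bool list \<Rightarrow> (nat \<Rightarrow> bool \<times> bool) \<Rightarrow> bool \<Rightarrow> bool" where
  "outputs \<pi> x y \<omega> v \<longleftrightarrow>
     (\<exists>j p. let t = transcript \<pi> x y \<omega> j in act \<pi> t = Answer p \<and> party_bit \<pi> x y \<omega> p t = v)"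


section \<open>Complexity classes\<close>

text \<open>Problems and protocols are families indexed by the input length.\<close>

definition solves :: "real \<Rightarrow> (nat \<Rightarrow> protocol) \<Rightarrow> promise_problem \<Rightarrow> bool" where
  "solves \<rho> \<Phi> P \<longleftrightarrow>
     (\<forall>n. \<forall>(x, y) \<in> yes_inst P n. \<P>(\<omega> in corr_space \<rho>. outputs (\<Phi> n) x y \<omega> True) \<ge> 2 / 3) \<and>
     (\<forall>n. \<forall>(x, y) \<in> no_inst P n. \<P>(\<omega> in corr_space \<rho>. outputs (\<Phi> n) x y \<omega> False) \<ge> 2 / 3)"

text \<open>The supremum ranges over all inputs, also those outside the promise.\<close>

definition cost :: "real \<Rightarrow> (nat \<Rightarrow> protocol) \<Rightarrow> ennreal" where
  "cost \<rho> \<Phi> =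
     (SUP n. SUP (x, y) \<in> cube n \<times> cube n. \<integral>\<^sup>+\<omega>. bits_sent (\<Phi> n) x y \<omega> \<partial>corr_space \<rho>)"

text \<open>That the minimum cost of a protocol is at most \<open>k\<close> is read as the existence of a protocol
  of cost at most \<open>k\<close>.\<close>

definition ISR_CC :: "real \<Rightarrow> real \<Rightarrow> promise_problem set" where
  "ISR_CC \<rho> k = {P. is_promise_problem P \<and>
     (\<exists>\<Phi>. (\<forall>n. measurable_protocol (\<Phi> n)) \<and> solves \<rho> \<Phi> P \<and> cost \<rho> \<Phi> \<le> ennreal k)}"

definition ISR_CC_one_way :: "real \<Rightarrow> real \<Rightarrow> promise_problem set" where
  "ISR_CC_one_way \<rho> k = {P. is_promise_problem P \<and>
     (\<exists>\<Phi>. (\<forall>n. measurable_protocol (\<Phi> n) \<and> one_way (\<Phi> n)) \<and> solves \<rho> \<Phi> P \<and>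
          cost \<rho> \<Phi> \<le> ennreal k)}"

definition PSR_CC :: "real \<Rightarrow> promise_problem set" where
  "PSR_CC k = ISR_CC 1 k"

end

theory Submission
  imports Defs
begin

text \<open>
  Cut the given protocol off after \<open>T = 12 k\<close> bits; by Markov's inequality this costs at most
  \<open>1/12\<close> in success probability. The probability that the truncated protocol accepts is
  \<open>\<Sum>\<^sub>t P(A\<^sub>t \<and> B\<^sub>t)\<close> over transcripts \<open>t\<close>, where \<open>A\<^sub>t\<close> (\<open>B\<^sub>t\<close>) says that Alice (Bob) behaves
  consistently with \<open>t\<close>. Hence it is an inner product \<open>\<langle>a\<^sub>x, b\<^sub>y\<rangle>\<close> of vectors of squared norm at most
  \<open>N = 2\<^bsup>T + 1\<^esup>\<close>, whose dimension does not matter. It remains to tell \<open>\<langle>a, b\<rangle> \<ge> 7/12\<close> from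
  \<open>\<langle>a, b\<rangle> \<le> 5/12\<close>. For correlated signs \<open>r, r'\<close> one has
  \<open>E[(\<Sum> a\<^sub>i r\<^sub>i) (\<Sum> b\<^sub>i r'\<^sub>i)] = \<rho> \<langle>a, b\<rangle>\<close>. Alice sends, for several independent blocks of signs, a
  rounding of \<open>s \<Sum> a\<^sub>i r\<^sub>i\<close> to an integer in \<open>[-K, K]\<close>, written in unary; Bob averages the products
  with his sums. The fourth moment of \<open>\<Sum> a\<^sub>i r\<^sub>i\<close> controls the rounding bias and Chebyshev's
  inequality the fluctuation, with all parameters polynomial in \<open>N\<close> and \<open>1/\<rho>\<close>.
\<close>

section \<open>Sums of independent random variables\<close>

lemma (in prob_space) expectation_mult_indep_compose:
  fixes X Y f g :: "_ \<Rightarrow> real"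
  assumes "indep_var borel X borel Y"
    and "f \<in> borel_measurable borel" "g \<in> borel_measurable borel"
    and "integrable M (\<lambda>\<omega>. f (X \<omega>))" "integrable M (\<lambda>\<omega>. g (Y \<omega>))"
  shows "expectation (\<lambda>\<omega>. f (X \<omega>) * g (Y \<omega>)) = expectation (\<lambda>\<omega>. f (X \<omega>)) * expectation (\<lambda>\<omega>. g (Y \<omega>))"
    and "integrable M (\<lambda>\<omega>. f (X \<omega>) * g (Y \<omega>))"
  using indep_var_compose[OF assms(1-3)] assms(4,5)
    indep_var_lebesgue_integral[of "f \<circ> X" "g \<circ> Y"] indep_var_integrable[of "f \<circ> X" "g \<circ> Y"]
  by (auto simp: comp_def)

text \<open>Induction on \<open>J\<close>: the new summand is independent of the partial sum, so the
  mixed term factors. Square integrability of the partial sum is carried along with the variance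
  because \<open>variance_eq\<close> consumes it at the next stage.\<close>

lemma (in prob_space) variance_sum_indep:
  fixes W :: "'i \<Rightarrow> 'a \<Rightarrow> real"
  assumes "finite J" "indep_vars (\<lambda>_. borel) W J"
    and "\<And>j. j \<in> J \<Longrightarrow> integrable M (\<lambda>\<omega>. (W j \<omega>)\<^sup>2)"
  shows "integrable M (\<lambda>\<omega>. (\<Sum>j\<in>J. W j \<omega>)\<^sup>2)"
    and "variance (\<lambda>\<omega>. \<Sum>j\<in>J. W j \<omega>) = (\<Sum>j\<in>J. variance (W j))"
proof -
  have "integrable M (\<lambda>\<omega>. (\<Sum>j\<in>J. W j \<omega>)\<^sup>2) \<and>
    variance (\<lambda>\<omega>. \<Sum>j\<in>J. W j \<omega>) = (\<Sum>j\<in>J. variance (W j))"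
    using assms
  proof (induction J rule: finite_induct)
    case empty
    then show ?case by simp
  next
    case (insert i J)
    let ?S = "\<lambda>\<omega>. \<Sum>j\<in>J. W j \<omega>"
    have rv: "random_variable borel (W j)" if "j \<in> insert i J" for j
      using insert.prems(1) that by (auto simp: indep_vars_def)
    have IH: "integrable M (\<lambda>\<omega>. (?S \<omega>)\<^sup>2)" "variance ?S = (\<Sum>j\<in>J. variance (W j))"
      using insert.IH insert.prems indep_vars_subset[OF insert.prems(1), of J] by auto
    have W1: "integrable M (W j)" if "j \<in> insert i J" for j
      using square_integrable_imp_integrable[OF rv insert.prems(2)] that by blast
    have S1: "integrable M ?S"
      using W1 by (intro Bochner_Integration.integrable_sum) auto
    have ind: "indep_var borel (W i) borel ?S"
      using insert.hyps insert.prems(1) by (intro indep_vars_sum) auto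
    have WS: "integrable M (\<lambda>\<omega>. W i \<omega> * ?S \<omega>)"
      using indep_var_integrable[OF ind] W1 S1 by blast
    have EWS: "expectation (\<lambda>\<omega>. W i \<omega> * ?S \<omega>) = expectation (W i) * expectation ?S"
      using indep_var_lebesgue_integral[OF ind] W1 S1 by blast
    have Wi: "integrable M (\<lambda>\<omega>. (W i \<omega>)\<^sup>2)"
      using insert.prems(2) by simp
    have eq: "(\<Sum>j\<in>insert i J. W j \<omega>)\<^sup>2 = (W i \<omega>)\<^sup>2 + 2 * (W i \<omega> * ?S \<omega>) + (?S \<omega>)\<^sup>2" for \<omega>
      using insert.hyps by (simp add: power2_sum)
    have int: "integrable M (\<lambda>\<omega>. (\<Sum>j\<in>insert i J. W j \<omega>)\<^sup>2)"
      unfolding eq using Wi WS IH(1) by simp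
    have mean: "expectation (\<lambda>\<omega>. \<Sum>j\<in>insert i J. W j \<omega>) = expectation (W i) + expectation ?S"
      using insert.hyps W1 S1 by simp
    have int1: "integrable M (\<lambda>\<omega>. \<Sum>j\<in>insert i J. W j \<omega>)"
      using W1 by (intro Bochner_Integration.integrable_sum) auto
    have "variance (\<lambda>\<omega>. \<Sum>j\<in>insert i J. W j \<omega>) =
        expectation (\<lambda>\<omega>. (W i \<omega>)\<^sup>2 + 2 * (W i \<omega> * ?S \<omega>) + (?S \<omega>)\<^sup>2) -
          (expectation (W i) + expectation ?S)\<^sup>2"
      using variance_eq[OF int1 int] unfolding mean eq .
    also have "\<dots> = variance (W i) + variance ?S"
      unfolding variance_eq[OF W1[OF insertI1] Wi] variance_eq[OF S1 IH(1)]
      using Wi WS IH(1) EWS by (simp add: power2_sum)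
    finally show ?case
      using int IH(2) insert.hyps by simp
  qed
  then show "integrable M (\<lambda>\<omega>. (\<Sum>j\<in>J. W j \<omega>)\<^sup>2)"
    "variance (\<lambda>\<omega>. \<Sum>j\<in>J. W j \<omega>) = (\<Sum>j\<in>J. variance (W j))"
    by auto
qed

lemma (in prob_space) variance_le_second_moment:
  fixes X :: "'a \<Rightarrow> real"
  assumes "random_variable borel X" "integrable M (\<lambda>\<omega>. (X \<omega>)\<^sup>2)"
  shows "variance X \<le> expectation (\<lambda>\<omega>. (X \<omega>)\<^sup>2)"
  using variance_eq[OF square_integrable_imp_integrable[OF assms] assms(2)] by simp

text \<open>Chebyshev's inequality, with each variance bounded by the second moment, which is the
  quantity that is easy to control for the sketch terms.\<close>

lemma (in prob_space) prob_sum_indep_deviation: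
  fixes W :: "'i \<Rightarrow> 'a \<Rightarrow> real"
  assumes J: "finite J" and ind: "indep_vars (\<lambda>_. borel) W J"
    and int: "\<And>j. j \<in> J \<Longrightarrow> integrable M (\<lambda>\<omega>. (W j \<omega>)\<^sup>2)"
    and V: "\<And>j. j \<in> J \<Longrightarrow> expectation (\<lambda>\<omega>. (W j \<omega>)\<^sup>2) \<le> V"
    and "\<delta> > 0"
  shows "prob {\<omega> \<in> space M. \<bar>(\<Sum>j\<in>J. W j \<omega>) - (\<Sum>j\<in>J. expectation (W j))\<bar> \<ge> \<delta>}
    \<le> real (card J) * V / \<delta>\<^sup>2"
proof -
  have rv: "random_variable borel (W j)" if "j \<in> J" for j
    using ind that by (auto simp: indep_vars_def)
  have W1: "integrable M (W j)" if "j \<in> J" for j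
    using square_integrable_imp_integrable[OF rv int] that by blast
  have "random_variable borel (\<lambda>\<omega>. \<Sum>j\<in>J. W j \<omega>)"
    using rv by simp
  then have "prob {\<omega> \<in> space M. \<bar>(\<Sum>j\<in>J. W j \<omega>) - expectation (\<lambda>\<omega>. \<Sum>j\<in>J. W j \<omega>)\<bar> \<ge> \<delta>}
    \<le> variance (\<lambda>\<omega>. \<Sum>j\<in>J. W j \<omega>) / \<delta>\<^sup>2"
    by (intro Chebyshev_inequality variance_sum_indep assms)
  also have "variance (\<lambda>\<omega>. \<Sum>j\<in>J. W j \<omega>) \<le> real (card J) * V"
    by (subst variance_sum_indep(2)[OF J ind])
       (intro sum_bounded_above order_trans[OF variance_le_second_moment V] rv int; assumption)+
  finally show ?thesis
    using W1 \<open>\<delta> > 0\<close> by (simp add: divide_right_mono)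
qed

text \<open>Khintchine's inequality for exponent 4. When (X + S)^4 is expanded, the terms odd in the
  new variable X have mean 0 and X^2 is the constant c^2. This leaves c^4 + 6 c^2 q + E[S^4] with q
  = E[S^2], which is at most 3 (c^2 + q)^2. The second moment is part of the same induction because
  q enters here.\<close>

lemma (in prob_space) fourth_moment_sum:
  fixes X :: "'i \<Rightarrow> 'a \<Rightarrow> real"
  assumes "finite I" "indep_vars (\<lambda>_. borel) X I"
    and "\<And>i \<omega>. i \<in> I \<Longrightarrow> \<bar>X i \<omega>\<bar> = c i"
    and "\<And>i. i \<in> I \<Longrightarrow> expectation (X i) = 0"
  shows "expectation (\<lambda>\<omega>. (\<Sum>i\<in>I. X i \<omega>) ^ 4) \<le> 3 * (\<Sum>i\<in>I. (c i)\<^sup>2)\<^sup>2"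
    and "expectation (\<lambda>\<omega>. (\<Sum>i\<in>I. X i \<omega>)\<^sup>2) = (\<Sum>i\<in>I. (c i)\<^sup>2)"
proof -
  have "expectation (\<lambda>\<omega>. (\<Sum>i\<in>I. X i \<omega>) ^ 4) \<le> 3 * (\<Sum>i\<in>I. (c i)\<^sup>2)\<^sup>2 \<and>
    expectation (\<lambda>\<omega>. (\<Sum>i\<in>I. X i \<omega>)\<^sup>2) = (\<Sum>i\<in>I. (c i)\<^sup>2)"
    using assms
  proof (induction I rule: finite_induct)
    case empty
    then show ?case by simp
  next
    case (insert i I)
    let ?S = "\<lambda>\<omega>. \<Sum>j\<in>I. X j \<omega>" and ?q = "\<Sum>j\<in>I. (c j)\<^sup>2"
    have rv [measurable]: "random_variable borel (X j)" if "j \<in> insert i I" for j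
      using insert.prems(1) that by (auto simp: indep_vars_def)
    have [measurable]: "random_variable borel ?S"
      using rv by simp
    have IH: "expectation (\<lambda>\<omega>. (?S \<omega>) ^ 4) \<le> 3 * ?q\<^sup>2" "expectation (\<lambda>\<omega>. (?S \<omega>)\<^sup>2) = ?q"
      using insert.IH insert.prems indep_vars_subset[OF insert.prems(1), of I] by auto
    have S_le: "\<bar>?S \<omega>\<bar> \<le> (\<Sum>j\<in>I. c j)" for \<omega>
      using sum_abs[of "\<lambda>j. X j \<omega>" I] insert.prems(2) by simp
    have S_int: "integrable M (\<lambda>\<omega>. ?S \<omega> ^ n)" for n
      by (rule integrable_const_bound[where B = "(\<Sum>j\<in>I. c j) ^ n"])
         (use S_le in \<open>auto simp: power_abs intro!: power_mono\<close>)
    have X_int: "integrable M (X i)"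
      by (rule integrable_const_bound[where B = "c i"]) (use insert.prems(2) in auto)
    have ind: "indep_var borel (X i) borel ?S"
      using insert.hyps insert.prems(1) by (intro indep_vars_sum) auto
    have cross: "expectation (\<lambda>\<omega>. X i \<omega> * ?S \<omega> ^ n) = 0" "integrable M (\<lambda>\<omega>. X i \<omega> * ?S \<omega> ^ n)" for n
      using expectation_mult_indep_compose[OF ind, of "\<lambda>x. x" "\<lambda>x. x ^ n"] X_int S_int[of n]
        insert.prems(3)[of i] by auto
    have X2: "(X i \<omega>)\<^sup>2 = (c i)\<^sup>2" for \<omega>
      using insert.prems(2)[of i \<omega>] by (metis insertI1 power2_abs)
    have ins: "(\<Sum>j\<in>insert i I. X j \<omega>) = X i \<omega> + ?S \<omega>" for \<omega>
      using insert.hyps by simp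
    \<comment> \<open>Even powers of \<open>X i\<close> are extracted as constants. What remains
      random are powers of \<open>?S\<close> and products \<open>X i * ?S ^ n\<close>, the exact
      shape of \<open>cross\<close>; this is why \<open>?S ^ 1\<close> is kept.\<close>
    have eq4: "(\<Sum>j\<in>insert i I. X j \<omega>) ^ 4 =
        (c i) ^ 4 + 4 * (c i)\<^sup>2 * (X i \<omega> * ?S \<omega> ^ 1) + 6 * (c i)\<^sup>2 * ?S \<omega> ^ 2
          + 4 * (X i \<omega> * ?S \<omega> ^ 3) + ?S \<omega> ^ 4" for \<omega>
    proof -
      have expand: "(x + y) ^ 4 = x\<^sup>2 * x\<^sup>2 + 4 * x\<^sup>2 * (x * y) + 6 * x\<^sup>2 * y\<^sup>2 + 4 * (x * y ^ 3) + y ^ 4"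
        for x y :: real
        by algebra
      have c4: "c i ^ 4 = (c i)\<^sup>2 * (c i)\<^sup>2"
        by algebra
      show ?thesis
        unfolding ins expand X2 c4 power_one_right by (rule refl)
    qed
    have eq2: "(\<Sum>j\<in>insert i I. X j \<omega>)\<^sup>2 = (c i)\<^sup>2 + 2 * (X i \<omega> * ?S \<omega> ^ 1) + ?S \<omega> ^ 2" for \<omega>
      unfolding ins by (simp add: power2_sum X2)
    have "expectation (\<lambda>\<omega>. (\<Sum>j\<in>insert i I. X j \<omega>) ^ 4) =
        (c i) ^ 4 + 6 * (c i)\<^sup>2 * ?q + expectation (\<lambda>\<omega>. ?S \<omega> ^ 4)"
      unfolding eq4 using cross[of 1] cross[of 3] S_int[of 2] S_int[of 4] IH(2)
      by (simp add: prob_space)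
    also have "\<dots> \<le> 3 * ((c i)\<^sup>2 + ?q)\<^sup>2"
    proof -
      have "3 * ((c i)\<^sup>2 + ?q)\<^sup>2 = 3 * (c i) ^ 4 + 6 * (c i)\<^sup>2 * ?q + 3 * ?q\<^sup>2"
        by algebra
      moreover have "0 \<le> (c i) ^ 4" by simp
      ultimately show ?thesis
        using IH(1) by linarith
    qed
    finally have 4: "expectation (\<lambda>\<omega>. (\<Sum>j\<in>insert i I. X j \<omega>) ^ 4) \<le> 3 * (\<Sum>j\<in>insert i I. (c j)\<^sup>2)\<^sup>2"
      using insert.hyps by simp
    have "expectation (\<lambda>\<omega>. (\<Sum>j\<in>insert i I. X j \<omega>)\<^sup>2) = (c i)\<^sup>2 + ?q"
      unfolding eq2 using cross[of 1] S_int[of 2] IH(2) by (simp add: prob_space)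
    with 4 show ?case
      using insert.hyps by simp
  qed
  then show "expectation (\<lambda>\<omega>. (\<Sum>i\<in>I. X i \<omega>) ^ 4) \<le> 3 * (\<Sum>i\<in>I. (c i)\<^sup>2)\<^sup>2"
    and "expectation (\<lambda>\<omega>. (\<Sum>i\<in>I. X i \<omega>)\<^sup>2) = (\<Sum>i\<in>I. (c i)\<^sup>2)"
    by auto
qed

section \<open>Moments of correlated sign sums\<close>

text \<open>Rounding up and clamping to \<open>[-K, K]\<close> (lemma \<open>quantize_eq\<close>), written as a sum over the bits of
  the unary code so that Bob can decode linearly.\<close>

definition quantize :: "nat \<Rightarrow> real \<Rightarrow> real" where
  "quantize K u = (\<Sum>i<2 * K. pm (u > real i - real K)) / 2"

section \<open>Closed form and error of the quantizer\<close>

lemma sum_pm_less: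
  assumes "n \<le> m"
  shows "(\<Sum>i<m. pm (i < n)) = 2 * real n - real m"
proof -
  have "(\<Sum>i<m. pm (i < n)) = (\<Sum>i<m. 2 * (if i < n then 1 else 0) - 1)"
    by (intro sum.cong) (auto simp: pm_def)
  also have "\<dots> = 2 * real (card {i \<in> {..<m}. i < n}) - real m"
    by (simp add: sum_subtractf sum_distrib_left[symmetric] sum.inter_filter[symmetric])
  also have "{i \<in> {..<m}. i < n} = {..<n}"
    using assms by auto
  finally show ?thesis by simp
qed

lemma quantize_eq: "quantize K u = max (- real K) (min (real K) (of_int \<lceil>u\<rceil>))"
proof -
  \<comment> \<open>The number of positive unary bits: \<open>u\<close> exceeds an integer threshold
    iff its ceiling does. With \<open>n\<close> bits counting 1 and \<open>2 * K - n\<close> bits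
    counting -1, half the sum is \<open>n - K\<close>.\<close>
  define n where "n = nat (min (2 * int K) (\<lceil>u\<rceil> + int K))"
  have "u > real i - real K \<longleftrightarrow> i < n" if "i < 2 * K" for i
  proof -
    have "u > real i - real K \<longleftrightarrow> u > of_int (int i - int K)"
      by simp
    also have "\<dots> \<longleftrightarrow> \<lceil>u\<rceil> > int i - int K"
      by (simp only: less_ceiling_iff)
    finally show ?thesis
      using that by (auto simp: n_def)
  qed
  then have "quantize K u = (\<Sum>i<2 * K. pm (i < n)) / 2"
    by (simp add: quantize_def)
  also have "\<dots> = real n - real K"
    by (subst sum_pm_less) (auto simp: n_def)
  also have "\<dots> = of_int (max (- int K) (min (int K) \<lceil>u\<rceil>))"
    by (auto simp: n_def max_def min_def)
  finally show ?thesis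
    by (simp add: of_int_max of_int_min)
qed

text \<open>Within \<open>[-K, K]\<close> only rounding occurs, with error at most 1. Outside,
  clamping moves \<open>u\<close> towards 0 without crossing it, so the error is at most
  \<bar>u\<bar>; there u^2 is at most u^4 / K^2, which a fourth moment can control.\<close>

lemma quantize_error:
  assumes "K > 0"
  shows "(quantize K u - u)\<^sup>2 \<le> 1 + u ^ 4 / (real K)\<^sup>2"
proof (cases "\<bar>u\<bar> \<le> K")
  case True
  then have "\<lceil>u\<rceil> \<le> int K" "- int K \<le> \<lceil>u\<rceil>"
    by (simp_all add: ceiling_le_iff) linarith
  then have "quantize K u = of_int \<lceil>u\<rceil>"
    unfolding quantize_eq max_def min_def by auto
  then have "\<bar>quantize K u - u\<bar> \<le> 1"
    by linarith
  then have "(quantize K u - u)\<^sup>2 \<le> 1"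
    by (simp add: abs_square_le_1)
  moreover have "0 \<le> u ^ 4 / (real K)\<^sup>2"
    by simp
  ultimately show ?thesis by linarith
next
  case False
  then have "\<bar>quantize K u - u\<bar> \<le> \<bar>u\<bar>"
    using assms unfolding quantize_eq max_def min_def by (auto; linarith)
  then have "(quantize K u - u)\<^sup>2 \<le> u\<^sup>2"
    by (simp add: abs_le_square_iff)
  also have "u\<^sup>2 \<le> u ^ 4 / (real K)\<^sup>2"
  proof -
    have "(real K)\<^sup>2 \<le> u\<^sup>2"
      using False by (simp add: abs_le_square_iff[symmetric])
    then have "u\<^sup>2 * (real K)\<^sup>2 \<le> u\<^sup>2 * u\<^sup>2"
      by (rule mult_left_mono) simp
    also have "u\<^sup>2 * u\<^sup>2 = u ^ 4"
      by algebra
    finally show ?thesis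
      using assms by (simp add: field_simps)
  qed
  finally show ?thesis by simp
qed

lemma quantize_measurable [measurable]: "quantize K \<in> borel_measurable borel"
  unfolding quantize_def[abs_def] pm_def by measurable

lemma abs_quantize: "\<bar>quantize K u\<bar> \<le> K"
  unfolding quantize_def using sum_abs[of "\<lambda>i. pm (u > real i - real K)" "{..<2*K}"]
  by (auto simp: pm_def if_distrib cong: if_cong)

section \<open>Independence of the coordinates of the correlated sequence\<close>

lemma corr_space_component_measurable:
  "(\<lambda>\<omega>. f (\<omega> i)) \<in> measurable (corr_space \<rho>) (count_space UNIV)"
proof -
  have "(\<lambda>\<omega>. \<omega> i) \<in> measurable (corr_space \<rho>) (measure_pmf (corr_pair \<rho>))"
    unfolding corr_space_def by (rule measurable_component_singleton) simp
  then show ?thesis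
    by (rule measurable_compose) simp
qed

lemma corr_space_borel_measurable [measurable]:
  "(\<lambda>\<omega>. f (\<omega> i) :: real) \<in> borel_measurable (corr_space \<rho>)"
  by (rule measurable_compose[OF corr_space_component_measurable[of "\<lambda>z. z"]]) simp

text \<open>Independence means that the joint law of the coordinates is the product of their laws,
  and \<open>corr_space\<close> is this product by definition.\<close>

lemma indep_vars_corr_space_components:
  "prob_space.indep_vars (corr_space \<rho>) (\<lambda>_. measure_pmf (corr_pair \<rho>)) (\<lambda>i \<omega>. \<omega> i) UNIV"
proof -
  interpret prob_space "corr_space \<rho>" by (rule prob_space_corr_space)
  have rv: "random_variable (measure_pmf (corr_pair \<rho>)) (\<lambda>\<omega>. \<omega> i)" for i
    unfolding corr_space_def by (rule measurable_component_singleton) simp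
  have d: "distr (corr_space \<rho>) (measure_pmf (corr_pair \<rho>)) (\<lambda>\<omega>. \<omega> i) = measure_pmf (corr_pair \<rho>)" for i
    unfolding corr_space_def by (rule distr_PiM_component) (auto intro: measure_pmf.prob_space_axioms)
  show ?thesis
    by (subst indep_vars_iff_distr_eq_PiM'[OF _ rv]) (simp_all add: d, simp add: corr_space_def restrict_UNIV distr_id)
qed

lemma indep_vars_corr_space_blocks:
  assumes "disjoint_family_on B J" and "\<And>j. j \<in> J \<Longrightarrow> W j \<in> borel_measurable (PiM (B j) (\<lambda>_. count_space UNIV))"
  shows "prob_space.indep_vars (corr_space \<rho>) (\<lambda>_. borel :: real measure) (\<lambda>j \<omega>. W j (restrict \<omega> (B j))) J"
proof -
  interpret prob_space "corr_space \<rho>" by (rule prob_space_corr_space)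
  have "indep_vars (\<lambda>j. PiM (B j) (\<lambda>_. measure_pmf (corr_pair \<rho>)))
      (\<lambda>j \<omega>. restrict (\<lambda>i. \<omega> i) (B j)) J"
    by (rule indep_vars_restrict[OF indep_vars_corr_space_components _ assms(1)]) auto
  \<comment> \<open>The assumption speaks of discrete coordinate spaces; the measures of the PMF
    have the same sigma-algebra, hence so do the products.\<close>
  moreover have "W j \<in> borel_measurable (PiM (B j) (\<lambda>_. measure_pmf (corr_pair \<rho>)))" if "j \<in> J" for j
    using assms(2)[OF that] measurable_cong_sets[OF sets_PiM_cong[OF refl, of "B j" "\<lambda>_. count_space UNIV" "\<lambda>_. measure_pmf (corr_pair \<rho>)"] refl, of "borel :: real measure"] by auto
  ultimately show ?thesis
    by (rule indep_vars_compose2)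
qed

lemma indep_vars_corr_space_linear:
  "prob_space.indep_vars (corr_space \<rho>) (\<lambda>_. borel) (\<lambda>i \<omega>. a i * f (\<omega> i) :: real) I"
proof -
  interpret prob_space "corr_space \<rho>" by (rule prob_space_corr_space)
  show ?thesis
    by (rule indep_vars_compose2[OF indep_vars_subset[OF indep_vars_corr_space_components]]) auto
qed

lemma expectation_corr_space_component:
  fixes f :: "bool \<times> bool \<Rightarrow> real"
  shows "prob_space.expectation (corr_space \<rho>) (\<lambda>\<omega>. f (\<omega> i)) = measure_pmf.expectation (corr_pair \<rho>) f"
proof -
  have "measure_pmf (corr_pair \<rho>) = distr (corr_space \<rho>) (measure_pmf (corr_pair \<rho>)) (\<lambda>\<omega>. \<omega> i)"
    unfolding corr_space_def by (rule distr_PiM_component[symmetric]) (auto intro: measure_pmf.prob_space_axioms)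
  then have "measure_pmf.expectation (corr_pair \<rho>) f =
    integral\<^sup>L (distr (corr_space \<rho>) (measure_pmf (corr_pair \<rho>)) (\<lambda>\<omega>. \<omega> i)) f"
    by simp
  also have "\<dots> = prob_space.expectation (corr_space \<rho>) (\<lambda>\<omega>. f (\<omega> i))"
    by (rule integral_distr) (simp_all add: corr_space_def)
  finally show ?thesis ..
qed

lemma abs_pm [simp]: "\<bar>pm b\<bar> = 1"
  by (simp add: pm_def)

text \<open>A Rademacher sum. It takes a single sign sequence, so the same function serves Alice's
  and Bob's half of the randomness.\<close>

definition rad :: "nat set \<Rightarrow> (nat \<Rightarrow> real) \<Rightarrow> (nat \<Rightarrow> bool) \<Rightarrow> real" where
  "rad I a r = (\<Sum>i\<in>I. a i * pm (r i))"

locale correlation =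
  fixes \<rho> :: real
  assumes rho_pos: "0 < \<rho>" and rho_le_1: "\<rho> \<le> 1"
begin

sublocale prob_space "corr_space \<rho>"
  by (rule prob_space_corr_space)

lemma expectation_component:
  "expectation (\<lambda>\<omega>. pm (fst (\<omega> i))) = 0" "expectation (\<lambda>\<omega>. pm (snd (\<omega> i))) = 0"
  "expectation (\<lambda>\<omega>. pm (fst (\<omega> i)) * pm (snd (\<omega> i))) = \<rho>"
  using correlated_corr_pair[of \<rho>] rho_pos rho_le_1
    expectation_corr_space_component[of \<rho> "\<lambda>z. pm (fst z)" i]
    expectation_corr_space_component[of \<rho> "\<lambda>z. pm (snd z)" i]
    expectation_corr_space_component[of \<rho> "\<lambda>z. pm (fst z) * pm (snd z)" i]
  by (simp_all add: correlated_def case_prod_unfold)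

abbreviation rad_a :: "nat set \<Rightarrow> (nat \<Rightarrow> real) \<Rightarrow> (nat \<Rightarrow> bool \<times> bool) \<Rightarrow> real" where
  "rad_a I a \<equiv> \<lambda>\<omega>. rad I a (fst \<circ> \<omega>)"

abbreviation rad_b :: "nat set \<Rightarrow> (nat \<Rightarrow> real) \<Rightarrow> (nat \<Rightarrow> bool \<times> bool) \<Rightarrow> real" where
  "rad_b I b \<equiv> \<lambda>\<omega>. rad I b (snd \<circ> \<omega>)"

lemma rad_measurable [measurable]:
  "rad_a I a \<in> borel_measurable (corr_space \<rho>)" "rad_b I b \<in> borel_measurable (corr_space \<rho>)"
  unfolding rad_def comp_def by measurable

lemma abs_rad_le: "\<bar>rad_a I a \<omega>\<bar> \<le> (\<Sum>i\<in>I. \<bar>a i\<bar>)" "\<bar>rad_b I a \<omega>\<bar> \<le> (\<Sum>i\<in>I. \<bar>a i\<bar>)"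
  unfolding rad_def comp_def by (rule order_trans[OF sum_abs], simp add: abs_mult)+

text \<open>Signs at different positions are independent with mean 0, so only the diagonal of the
  double sum contributes to the mixed moment, each term with a factor \<rho>. The other two claims
  are \<open>fourth_moment_sum\<close> for summands of constant modulus.\<close>

lemma expectation_rad:
  assumes "finite I"
  shows "expectation (\<lambda>\<omega>. rad_a I a \<omega> * rad_b I b \<omega>) = \<rho> * (\<Sum>i\<in>I. a i * b i)"
    and "expectation (\<lambda>\<omega>. rad_a I a \<omega> ^ 4) \<le> 3 * (\<Sum>i\<in>I. (a i)\<^sup>2)\<^sup>2"
    and "expectation (\<lambda>\<omega>. (rad_b I b \<omega>)\<^sup>2) = (\<Sum>i\<in>I. (b i)\<^sup>2)"
proof -
  have int: "integrable (corr_space \<rho>) (\<lambda>\<omega>. a i * pm (fst (\<omega> i)) * (b j * pm (snd (\<omega> j))))" for i j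
    by (rule integrable_const_bound[where B = "\<bar>a i * b j\<bar>"])
       (simp_all add: abs_mult)
  have pair: "expectation (\<lambda>\<omega>. a i * pm (fst (\<omega> i)) * (b j * pm (snd (\<omega> j)))) =
      (if i = j then \<rho> * (a i * b j) else 0)" for i j
  proof -
    have eq: "expectation (\<lambda>\<omega>. a i * pm (fst (\<omega> i)) * (b j * pm (snd (\<omega> j)))) =
      a i * b j * expectation (\<lambda>\<omega>. pm (fst (\<omega> i)) * pm (snd (\<omega> j)))"
      by (subst integral_mult_right_zero[symmetric]) (simp add: algebra_simps)
    show ?thesis
    proof (cases "i = j")
      case True
      then show ?thesis using eq expectation_component(3) by simp
    next
      case False
      \<comment> \<open>A single family over \<open>{i, j}\<close> that takes Alice's sign at
        \<open>i\<close> and Bob's sign at \<open>j\<close>, so that independence of the coordinates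
        yields independence of these two signs.\<close>
      have "indep_vars (\<lambda>_. borel) (\<lambda>l \<omega>. 1 * (if l = i then pm (fst (\<omega> l)) else pm (snd (\<omega> l)))) {i, j}"
        by (rule indep_vars_compose2[OF indep_vars_subset[OF indep_vars_corr_space_components]]) auto
      then have "indep_var borel (\<lambda>\<omega>. pm (fst (\<omega> i))) borel (\<lambda>\<omega>. pm (snd (\<omega> j)))"
        using indep_vars_sum[of "{j}" i] False by fastforce
      then have "expectation (\<lambda>\<omega>. pm (fst (\<omega> i)) * pm (snd (\<omega> j))) = 0"
        by (subst indep_var_lebesgue_integral)
           (auto intro!: integrable_const_bound[where B = 1] simp: expectation_component)
      then show ?thesis using eq False by simp
    qed
  qed
  have "expectation (\<lambda>\<omega>. rad_a I a \<omega> * rad_b I b \<omega>) =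
      (\<Sum>i\<in>I. \<Sum>j\<in>I. expectation (\<lambda>\<omega>. a i * pm (fst (\<omega> i)) * (b j * pm (snd (\<omega> j)))))"
    unfolding rad_def comp_def sum_product using int by simp
  also have "\<dots> = \<rho> * (\<Sum>i\<in>I. a i * b i)"
    unfolding pair using assms by (simp add: sum_distrib_left)
  finally show "expectation (\<lambda>\<omega>. rad_a I a \<omega> * rad_b I b \<omega>) = \<rho> * (\<Sum>i\<in>I. a i * b i)" .
  show "expectation (\<lambda>\<omega>. rad_a I a \<omega> ^ 4) \<le> 3 * (\<Sum>i\<in>I. (a i)\<^sup>2)\<^sup>2"
    unfolding rad_def comp_def
    using fourth_moment_sum(1)[OF assms indep_vars_corr_space_linear[of \<rho> a "\<lambda>z. pm (fst z)"], of "\<lambda>i. \<bar>a i\<bar>"]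
    by (simp add: abs_mult expectation_component)
  show "expectation (\<lambda>\<omega>. (rad_b I b \<omega>)\<^sup>2) = (\<Sum>i\<in>I. (b i)\<^sup>2)"
    unfolding rad_def comp_def
    using fourth_moment_sum(2)[OF assms indep_vars_corr_space_linear[of \<rho> b "\<lambda>z. pm (snd z)"], of "\<lambda>i. \<bar>b i\<bar>"]
    by (simp add: abs_mult expectation_component)
qed

text \<open>The common source of the integrability facts below: Rademacher sums are bounded, so
  \<open>f\<close> only has to be bounded on an interval containing the values of the first one. The
  exponents 0, 1 and 2 occur.\<close>

lemma integrable_rad_powers:
  assumes [measurable]: "f \<in> borel_measurable borel" and f: "\<And>u. \<bar>u\<bar> \<le> (\<Sum>i\<in>I. \<bar>a i\<bar>) \<Longrightarrow> \<bar>f u\<bar> \<le> C"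
  shows "integrable (corr_space \<rho>) (\<lambda>\<omega>. f (rad_a I a \<omega>) * rad_b I b \<omega> ^ n)"
proof (rule integrable_const_bound)
  have "\<bar>f (rad_a I a \<omega>) * rad_b I b \<omega> ^ n\<bar> \<le> C * (\<Sum>i\<in>I. \<bar>b i\<bar>) ^ n" for \<omega>
    unfolding abs_mult power_abs
    using f[OF abs_rad_le(1)] order_trans[OF abs_ge_zero f[OF abs_rad_le(1)]] abs_rad_le(2)
    by (intro mult_mono power_mono) auto
  then show "AE \<omega> in corr_space \<rho>. norm (f (rad_a I a \<omega>) * rad_b I b \<omega> ^ n) \<le> C * (\<Sum>i\<in>I. \<bar>b i\<bar>) ^ n"
    by simp
qed measurable

context
  fixes I :: "nat set" and K :: nat and s N :: real and a b :: "nat \<Rightarrow> real"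
    and W :: "(nat \<Rightarrow> bool \<times> bool) \<Rightarrow> real"
  assumes I: "finite I" and K: "K > 0" and N: "(\<Sum>i\<in>I. (a i)\<^sup>2) \<le> N" "(\<Sum>i\<in>I. (b i)\<^sup>2) \<le> N"
  defines "W \<equiv> \<lambda>\<omega>. quantize K (s * rad_a I a \<omega>) * rad_b I b \<omega>"
begin

lemma integrable_quantized_product: "integrable (corr_space \<rho>) (\<lambda>\<omega>. (W \<omega>)\<^sup>2)"
  unfolding W_def power_mult_distrib
  by (rule integrable_rad_powers[where C = "(real K)\<^sup>2"])
     (use abs_quantize in \<open>auto intro: power_mono simp: power_abs[symmetric] abs_le_square_iff[symmetric]\<close>)

text \<open>Clamping bounds the first factor by \<open>K\<close>, which leaves the second moment of
  Bob's sum.\<close>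

lemma second_moment_quantized_product: "expectation (\<lambda>\<omega>. (W \<omega>)\<^sup>2) \<le> (real K)\<^sup>2 * N"
proof -
  have "expectation (\<lambda>\<omega>. (W \<omega>)\<^sup>2) \<le> expectation (\<lambda>\<omega>. (real K)\<^sup>2 * (rad_b I b \<omega>)\<^sup>2)"
  proof (rule integral_mono[OF integrable_quantized_product])
    show "integrable (corr_space \<rho>) (\<lambda>\<omega>. (real K)\<^sup>2 * (rad_b I b \<omega>)\<^sup>2)"
      using integrable_rad_powers[where f = "\<lambda>_. (real K)\<^sup>2" and I = I and a = a and C = "(real K)\<^sup>2" and b = b and n = 2] by simp
    show "(W \<omega>)\<^sup>2 \<le> (real K)\<^sup>2 * (rad_b I b \<omega>)\<^sup>2" for \<omega>
      unfolding W_def power_mult_distrib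
      using abs_quantize[of K] by (intro mult_right_mono) (auto simp: abs_le_square_iff[symmetric])
  qed
  also have "\<dots> = (real K)\<^sup>2 * (\<Sum>i\<in>I. (b i)\<^sup>2)"
    using expectation_rad(3)[OF I] by simp
  also have "\<dots> \<le> (real K)\<^sup>2 * N"
    using N by (intro mult_left_mono) auto
  finally show ?thesis .
qed

text \<open>By \<open>expectation_rad\<close> the difference equals E[e G], where e is the rounding
  error of \<open>s * rad_a I a\<close> and G is Bob's sum. Then 2 \<bar>e G\<bar> is at most e^2 +
  G^2, \<open>quantize_error\<close> bounds e^2, and the fourth moment of Alice's sum bounds the
  clamping part. The size of \<open>I\<close> does not enter.\<close>

lemma expectation_quantized_product:
  "\<bar>expectation W - s * \<rho> * (\<Sum>i\<in>I. a i * b i)\<bar> \<le> (1 + 3 * s ^ 4 * N\<^sup>2 / (real K)\<^sup>2 + N) / 2"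
proof -
  let ?F = "rad_a I a" and ?G = "rad_b I b"
  let ?e = "\<lambda>u. quantize K (s * u) - s * u"
  define FB where "FB = (\<Sum>i\<in>I. \<bar>a i\<bar>)"
  have FG: "integrable (corr_space \<rho>) (\<lambda>\<omega>. ?F \<omega> * ?G \<omega>)"
    using integrable_rad_powers[where f = "\<lambda>u. u" and I = I and a = a and C = FB and b = b and n = 1] by (simp add: FB_def)
  have F4: "integrable (corr_space \<rho>) (\<lambda>\<omega>. ?F \<omega> ^ 4)"
    using integrable_rad_powers[where f = "\<lambda>u. u ^ 4" and I = I and a = a and C = "FB ^ 4" and b = b and n = 0] by (simp add: FB_def power_mono_even)
  have G2: "integrable (corr_space \<rho>) (\<lambda>\<omega>. (?G \<omega>)\<^sup>2)"
    using integrable_rad_powers[where f = "\<lambda>_. 1" and I = I and a = a and C = 1 and b = b and n = 2] by simp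
  have QG: "integrable (corr_space \<rho>) (\<lambda>\<omega>. quantize K (s * ?F \<omega>) * ?G \<omega>)"
    using integrable_rad_powers[where f = "\<lambda>u. quantize K (s * u)" and I = I and a = a and C = K and b = b and n = 1] abs_quantize by simp
  have eG: "integrable (corr_space \<rho>) (\<lambda>\<omega>. ?e (?F \<omega>) * ?G \<omega>)"
    using FG QG by (simp add: left_diff_distrib mult.assoc)
  have "expectation W - s * \<rho> * (\<Sum>i\<in>I. a i * b i) = expectation (\<lambda>\<omega>. ?e (?F \<omega>) * ?G \<omega>)"
    using FG QG expectation_rad(1)[OF I, of a b]
    by (simp add: W_def left_diff_distrib mult.assoc)
  also have "\<bar>\<dots>\<bar> \<le> expectation (\<lambda>\<omega>. \<bar>?e (?F \<omega>) * ?G \<omega>\<bar>)"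
    by (rule integral_abs_bound)
  also have "\<dots> \<le> expectation (\<lambda>\<omega>. (1 + s ^ 4 / (real K)\<^sup>2 * ?F \<omega> ^ 4 + (?G \<omega>)\<^sup>2) / 2)"
  proof (rule integral_mono)
    fix \<omega>
    have "0 \<le> (\<bar>?e (?F \<omega>)\<bar> - \<bar>?G \<omega>\<bar>)\<^sup>2"
      by simp
    then have "2 * \<bar>?e (?F \<omega>) * ?G \<omega>\<bar> \<le> (?e (?F \<omega>))\<^sup>2 + (?G \<omega>)\<^sup>2"
      by (simp add: power2_diff abs_mult)
    then show "\<bar>?e (?F \<omega>) * ?G \<omega>\<bar> \<le> (1 + s ^ 4 / (real K)\<^sup>2 * ?F \<omega> ^ 4 + (?G \<omega>)\<^sup>2) / 2"
      using quantize_error[OF K, of "s * ?F \<omega>"] by (simp add: power_mult_distrib)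
  qed (use eG F4 G2 in auto)
  also have "\<dots> = (1 + s ^ 4 / (real K)\<^sup>2 * expectation (\<lambda>\<omega>. ?F \<omega> ^ 4) + (\<Sum>i\<in>I. (b i)\<^sup>2)) / 2"
    using F4 G2 expectation_rad(3)[OF I, of b] by (simp add: prob_space)
  also have "\<dots> \<le> (1 + s ^ 4 / (real K)\<^sup>2 * (3 * N\<^sup>2) + N) / 2"
  proof -
    have "expectation (\<lambda>\<omega>. ?F \<omega> ^ 4) \<le> 3 * (\<Sum>i\<in>I. (a i)\<^sup>2)\<^sup>2"
      by (rule expectation_rad(2)[OF I])
    also have "\<dots> \<le> 3 * N\<^sup>2"
      using N by (simp add: power_mono sum_nonneg)
    finally show ?thesis
      using N(2) by (intro divide_right_mono add_mono mult_left_mono) auto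
  qed
  finally show ?thesis
    by (simp add: algebra_simps)
qed

end

end

section \<open>One-way sketch of inner products\<close>

lemma
  assumes "\<And>t. act \<pi> t = (if length t < L then Send Alice else Answer Bob)"
  shows length_transcript_fixed_length: "length (transcript \<pi> x y \<omega> j) = min j L"
    and bits_sent_fixed_length: "bits_sent \<pi> x y \<omega> = of_nat L"
    and outputs_fixed_length:
      "outputs \<pi> x y \<omega> v \<longleftrightarrow> bob \<pi> y (snd \<circ> \<omega>) (transcript \<pi> x y \<omega> L) = v"
    and nth_transcript_fixed_length:
      "i < j \<Longrightarrow> j \<le> L \<Longrightarrow> transcript \<pi> x y \<omega> j ! i = alice \<pi> x (fst \<circ> \<omega>) (transcript \<pi> x y \<omega> i)"
proof -
  show len: "length (transcript \<pi> x y \<omega> j) = min j L" for j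
    by (induction j) (auto simp: Let_def assms)
  show "bits_sent \<pi> x y \<omega> = of_nat L"
    unfolding bits_sent_def len
    by (intro antisym SUP_least SUP_upper2[of L]) (auto simp: of_nat_mono)
  \<comment> \<open>After \<open>L\<close> bits nothing is appended any more, so at every later
    stage Bob answers on the same complete transcript.\<close>
  have stop: "transcript \<pi> x y \<omega> (L + i) = transcript \<pi> x y \<omega> L" for i
    by (induction i) (auto simp: Let_def assms len)
  have "act \<pi> (transcript \<pi> x y \<omega> j) = Answer p \<longleftrightarrow> p = Bob \<and> (\<exists>i. j = L + i)" for j p
    by (auto simp: assms len le_iff_add[symmetric])
  then show "outputs \<pi> x y \<omega> v \<longleftrightarrow> bob \<pi> y (snd \<circ> \<omega>) (transcript \<pi> x y \<omega> L) = v"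
    by (auto simp: outputs_def Let_def stop)
  show "i < j \<Longrightarrow> j \<le> L \<Longrightarrow> transcript \<pi> x y \<omega> j ! i = alice \<pi> x (fst \<circ> \<omega>) (transcript \<pi> x y \<omega> i)"
  proof (induction j)
    case (Suc j)
    then show ?case
      by (cases "i = j") (auto simp: Let_def assms len nth_append comp_def)
  qed simp
qed

section \<open>The sketch protocol\<close>

definition block :: "nat \<Rightarrow> nat \<Rightarrow> nat set" where
  "block D j = {j * D..<Suc j * D}"

text \<open>Every block uses the same \<open>D\<close> coefficients with fresh signs: on a block,
  \<open>i mod D\<close> takes each value below \<open>D\<close> once.\<close>

definition block_sum :: "nat \<Rightarrow> (nat \<Rightarrow> real) \<Rightarrow> nat \<Rightarrow> (nat \<Rightarrow> bool) \<Rightarrow> real" where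
  "block_sum D a j = rad (block D j) (\<lambda>i. a (i mod D))"

text \<open>Position \<open>j * (2 * K) + i\<close> of the message carries unary bit
  \<open>i\<close> for block \<open>j\<close>, which is why Alice splits the length of the
  transcript by \<open>div\<close> and \<open>mod\<close>. Bob's half sum of signs over one group of
  \<open>2 * K\<close> bits recovers \<open>quantize\<close> of Alice's scaled block sum.\<close>

definition sketch_protocol ::
    "nat \<Rightarrow> (bool list \<Rightarrow> nat \<Rightarrow> real) \<Rightarrow> (bool list \<Rightarrow> nat \<Rightarrow> real) \<Rightarrow> nat \<Rightarrow> real \<Rightarrow> nat \<Rightarrow> real \<Rightarrow> protocol" where
  "sketch_protocol D a b K s m \<tau> =
    \<lparr>act = \<lambda>t. if length t < m * (2 * K) then Send Alice else Answer Bob,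
     alice = \<lambda>x r t. s * block_sum D (a x) (length t div (2 * K)) r > real (length t mod (2 * K)) - real K,
     bob = \<lambda>y r t. (\<Sum>j<m. (\<Sum>i<2 * K. pm (t ! (j * (2 * K) + i))) / 2 * block_sum D (b y) j r) \<ge> \<tau>\<rparr>"

lemma finite_block [simp]: "finite (block D j)"
  by (simp add: block_def)

lemma disjoint_family_block: "disjoint_family (block D)"
proof -
  have "i div D = j" if "i \<in> block D j" for i j
    using that unfolding block_def by (intro div_nat_eqI) (auto simp: mult.commute)
  then show ?thesis
    unfolding disjoint_family_on_def by blast
qed

lemma sum_block: "(\<Sum>i\<in>block D j. f (i mod D)) = (\<Sum>d<D. f d)" for f :: "nat \<Rightarrow> real"
proof -
  have "(\<Sum>i\<in>block D j. f (i mod D)) = (\<Sum>i\<in>{0 + j * D..<D + j * D}. f (i mod D))"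
    by (simp add: block_def)
  also have "\<dots> = (\<Sum>d\<in>{0..<D}. f d)"
    unfolding sum.shift_bounds_nat_ivl by (intro sum.cong) auto
  finally show ?thesis
    by (simp add: atLeast0LessThan)
qed

lemma block_sum_measurable [measurable]: "block_sum D a j \<in> borel_measurable bit_seq_space"
  unfolding block_sum_def rad_def bit_seq_space_def by measurable

lemma measurable_sketch_protocol: "measurable_protocol (sketch_protocol D a b K s m \<tau>)"
  unfolding measurable_protocol_def sketch_protocol_def by simp

lemma one_way_sketch_protocol: "one_way (sketch_protocol D a b K s m \<tau>)"
  by (simp add: one_way_def sketch_protocol_def)

lemma act_sketch_protocol:
  "act (sketch_protocol D a b K s m \<tau>) t = (if length t < m * (2 * K) then Send Alice else Answer Bob)"
  by (simp add: sketch_protocol_def)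

lemma bits_sent_sketch_protocol: "bits_sent (sketch_protocol D a b K s m \<tau>) x y \<omega> = of_nat (m * (2 * K))"
  by (rule bits_sent_fixed_length[OF act_sketch_protocol])

lemma outputs_sketch_protocol:
  "outputs (sketch_protocol D a b K s m \<tau>) x y \<omega> v \<longleftrightarrow>
    ((\<Sum>j<m. quantize K (s * block_sum D (a x) j (fst \<circ> \<omega>)) * block_sum D (b y) j (snd \<circ> \<omega>)) \<ge> \<tau>) = v"
proof -
  let ?\<pi> = "sketch_protocol D a b K s m \<tau>" and ?L = "m * (2 * K)"
  have bit: "transcript ?\<pi> x y \<omega> ?L ! (j * (2 * K) + i) \<longleftrightarrow>
      s * block_sum D (a x) j (fst \<circ> \<omega>) > real i - real K" if "j < m" "i < 2 * K" for i j
  proof -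
    have "Suc j * (2 * K) \<le> ?L"
      using that(1) by (intro mult_right_mono) auto
    then have L: "j * (2 * K) + i < ?L"
      using that(2) by simp
    have "(j * (2 * K) + i) div (2 * K) = j" "(j * (2 * K) + i) mod (2 * K) = i"
      using that(2) by auto
    then show ?thesis
      using L nth_transcript_fixed_length[OF act_sketch_protocol[of D a b K s m \<tau>] L order_refl]
        length_transcript_fixed_length[OF act_sketch_protocol[of D a b K s m \<tau>], of x y \<omega> "j * (2 * K) + i"]
      by (simp add: sketch_protocol_def)
  qed
  have "(\<Sum>i<2 * K. pm (transcript ?\<pi> x y \<omega> ?L ! (j * (2 * K) + i))) / 2 =
      quantize K (s * block_sum D (a x) j (fst \<circ> \<omega>))" if "j < m" for j
    unfolding quantize_def using bit[OF that] by simp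
  then show ?thesis
    unfolding outputs_fixed_length[OF act_sketch_protocol]
    by (simp add: sketch_protocol_def)
qed

section \<open>Concentration and correctness of the sketch\<close>

context correlation
begin

text \<open>Term \<open>j\<close> is unchanged when \<omega> is restricted to block
  \<open>j\<close>, and the blocks are disjoint.\<close>

lemma indep_vars_sketch_terms:
  "indep_vars (\<lambda>_. borel)
    (\<lambda>j \<omega>. quantize K (s * block_sum D a j (fst \<circ> \<omega>)) * block_sum D b j (snd \<circ> \<omega>)) J"
proof -
  have "indep_vars (\<lambda>_. borel) (\<lambda>j \<omega>. (\<lambda>\<eta>. quantize K (s * block_sum D a j (fst \<circ> \<eta>)) * block_sum D b j (snd \<circ> \<eta>))
      (restrict \<omega> (block D j))) J"
  proof (rule indep_vars_corr_space_blocks)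
    show "disjoint_family_on (block D) J"
      using disjoint_family_block by (rule disjoint_family_on_mono[rotated]) simp
    have bit: "(\<lambda>\<eta>. c * pm (f (\<eta> i))) \<in> borel_measurable (PiM (block D j) (\<lambda>_. count_space UNIV))"
      if "i \<in> block D j" for f :: "bool \<times> bool \<Rightarrow> bool" and c i j
      by (rule measurable_compose[OF measurable_component_singleton[OF that]]) simp
    have [measurable]: "(\<lambda>\<eta>. block_sum D c j (f \<circ> \<eta>)) \<in> borel_measurable (PiM (block D j) (\<lambda>_. count_space UNIV))"
      for f :: "bool \<times> bool \<Rightarrow> bool" and c j
      unfolding block_sum_def rad_def comp_def by (intro borel_measurable_sum bit)
    show "(\<lambda>\<eta>. quantize K (s * block_sum D a j (fst \<circ> \<eta>)) * block_sum D b j (snd \<circ> \<eta>))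
        \<in> borel_measurable (PiM (block D j) (\<lambda>_. count_space UNIV))" for j
      by measurable
  qed
  moreover have "block_sum D c j (f \<circ> restrict \<omega> (block D j)) = block_sum D c j (f \<circ> \<omega>)"
    for c j \<omega> and f :: "bool \<times> bool \<Rightarrow> bool"
    unfolding block_sum_def rad_def by (intro sum.cong) auto
  ultimately show ?thesis
    by simp
qed

context
  fixes D K m :: nat and s N :: real
  assumes pos: "K > 0" "m > 0" "s > 0"
    and bias: "(1 + 3 * s ^ 4 * N\<^sup>2 / (real K)\<^sup>2 + N) / 2 \<le> s * \<rho> / 24"
    and spread: "1728 * ((real K)\<^sup>2 * N) \<le> m * (s * \<rho>)\<^sup>2"
begin

text \<open>The tolerance \<open>m * (s * \<rho> / 12)\<close> is split in two halves. By
  \<open>bias\<close> the sum of the means is off by at most one half; by \<open>spread\<close> and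
  Chebyshev the deviation from the sum of the means reaches the other half with probability at most
  1/3.\<close>

lemma sketch_concentration:
  assumes a: "(\<Sum>d<D. (a d)\<^sup>2) \<le> N" and b: "(\<Sum>d<D. (b d)\<^sup>2) \<le> N"
  defines "Z \<equiv> \<lambda>\<omega>. \<Sum>j<m. quantize K (s * block_sum D a j (fst \<circ> \<omega>)) * block_sum D b j (snd \<circ> \<omega>)"
  shows "prob {\<omega> \<in> space (corr_space \<rho>). \<bar>Z \<omega> - m * (s * \<rho> * (\<Sum>d<D. a d * b d))\<bar> < m * (s * \<rho> / 12)} \<ge> 2 / 3"
    and "Z \<in> borel_measurable (corr_space \<rho>)"
proof -
  let ?W = "\<lambda>j \<omega>. quantize K (s * block_sum D a j (fst \<circ> \<omega>)) * block_sum D b j (snd \<circ> \<omega>)"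
  let ?p = "\<Sum>d<D. a d * b d" and ?E = "\<lambda>j. expectation (?W j)"
  have dpos: "real m * (s * \<rho> / 24) > 0"
    using pos rho_pos by simp
  have rv [measurable]: "random_variable borel (?W j)" for j
    unfolding block_sum_def by measurable
  show [measurable]: "Z \<in> borel_measurable (corr_space \<rho>)"
    unfolding Z_def by (rule borel_measurable_sum) (rule rv)
  have a': "(\<Sum>i\<in>block D j. (a (i mod D))\<^sup>2) \<le> N" and b': "(\<Sum>i\<in>block D j. (b (i mod D))\<^sup>2) \<le> N" for j
    using a b by (simp_all only: sum_block[of "\<lambda>d. (a d)\<^sup>2"] sum_block[of "\<lambda>d. (b d)\<^sup>2"])
  note W = finite_block pos(1) a' b'
  have int: "integrable (corr_space \<rho>) (\<lambda>\<omega>. (?W j \<omega>)\<^sup>2)" for j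
    unfolding block_sum_def by (rule integrable_quantized_product[OF W])
  have V: "expectation (\<lambda>\<omega>. (?W j \<omega>)\<^sup>2) \<le> (real K)\<^sup>2 * N" for j
    unfolding block_sum_def by (rule second_moment_quantized_product[OF W])
  have E: "\<bar>?E j - s * \<rho> * ?p\<bar> \<le> s * \<rho> / 24" for j
    using order_trans[OF expectation_quantized_product[OF W] bias]
    unfolding block_sum_def sum_block[of "\<lambda>d. a d * b d"] .
  have "\<bar>(\<Sum>j<m. ?E j) - m * (s * \<rho> * ?p)\<bar> = \<bar>\<Sum>j<m. (?E j - s * \<rho> * ?p)\<bar>"
    by (simp add: sum_subtractf)
  also have "\<dots> \<le> (\<Sum>j<m. \<bar>?E j - s * \<rho> * ?p\<bar>)"
    by (rule sum_abs)
  also have "\<dots> \<le> of_nat (card {..<m}) * (s * \<rho> / 24)"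
    using E by (rule sum_bounded_above)
  finally have mean: "\<bar>(\<Sum>j<m. ?E j) - m * (s * \<rho> * ?p)\<bar> \<le> m * (s * \<rho> / 24)"
    by simp
  let ?bad = "{\<omega> \<in> space (corr_space \<rho>). \<bar>Z \<omega> - (\<Sum>j<m. ?E j)\<bar> \<ge> m * (s * \<rho> / 24)}"
  have "prob ?bad \<le> real (card {..<m}) * ((real K)\<^sup>2 * N) / (m * (s * \<rho> / 24))\<^sup>2"
    unfolding Z_def
    by (rule prob_sum_indep_deviation[OF finite_lessThan indep_vars_sketch_terms int V dpos])
  also have "\<dots> \<le> 1 / 3"
  proof -
    \<comment> \<open>Here 1728 = 3 * 24^2, where 24 comes from the deviation allowed in Chebyshev's
      inequality and 3 from the target 1/3.\<close>
    have "3 * (m * ((real K)\<^sup>2 * N)) = (real m / 576) * (1728 * ((real K)\<^sup>2 * N))"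
      by simp
    also have "\<dots> \<le> (real m / 576) * (m * (s * \<rho>)\<^sup>2)"
      using spread by (rule mult_left_mono) simp
    also have "\<dots> = (m * (s * \<rho> / 24))\<^sup>2"
      by (simp add: power_mult_distrib power_divide power2_eq_square)
    finally show ?thesis
      using dpos by (simp add: divide_le_eq)
  qed
  finally have bad: "prob ?bad \<le> 1 / 3" .
  have "2 / 3 \<le> prob (space (corr_space \<rho>) - ?bad)"
    using bad by (subst prob_compl) auto
  also have "\<dots> \<le> prob {\<omega> \<in> space (corr_space \<rho>). \<bar>Z \<omega> - m * (s * \<rho> * ?p)\<bar> < m * (s * \<rho> / 12)}"
  proof (rule finite_measure_mono)
    have "2 * (m * (s * \<rho> / 24)) = m * (s * \<rho> / 12)"
      by simp
    then show "space (corr_space \<rho>) - ?bad \<subseteq>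
        {\<omega> \<in> space (corr_space \<rho>). \<bar>Z \<omega> - m * (s * \<rho> * ?p)\<bar> < m * (s * \<rho> / 12)}"
      using mean by (intro subsetI CollectI conjI) (simp, simp only: Diff_iff mem_Collect_eq, linarith)
  qed measurable
  finally show "prob {\<omega> \<in> space (corr_space \<rho>). \<bar>Z \<omega> - m * (s * \<rho> * ?p)\<bar> < m * (s * \<rho> / 12)} \<ge> 2 / 3" .
qed

text \<open>In units of \<open>c = m * (s * \<rho> / 12)\<close> Bob's threshold is 6, while the
  target value of \<open>Z\<close> is at least 7 in the first case and at most 5 in the second. A
  deviation below 1 cannot cross the threshold.\<close>

lemma sketch_protocol_correct:
  assumes "(\<Sum>d<D. (a x d)\<^sup>2) \<le> N" "(\<Sum>d<D. (b y d)\<^sup>2) \<le> N"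
  defines "\<pi> \<equiv> sketch_protocol D a b K s m (m * (s * \<rho> / 2))"
  shows "(\<Sum>d<D. a x d * b y d) \<ge> 7 / 12 \<Longrightarrow>
      \<P>(\<omega> in corr_space \<rho>. outputs \<pi> x y \<omega> True) \<ge> 2 / 3"
    and "(\<Sum>d<D. a x d * b y d) \<le> 5 / 12 \<Longrightarrow>
      \<P>(\<omega> in corr_space \<rho>. outputs \<pi> x y \<omega> False) \<ge> 2 / 3"
proof -
  define Z where "Z = (\<lambda>\<omega>. \<Sum>j<m. quantize K (s * block_sum D (a x) j (fst \<circ> \<omega>)) * block_sum D (b y) j (snd \<circ> \<omega>))"
  define p where "p = (\<Sum>d<D. a x d * b y d)"
  define c where "c = real m * (s * \<rho> / 12)"
  have c: "c > 0" "m * (s * \<rho> * p) = 12 * c * p" "m * (s * \<rho> / 2) = 6 * c"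
    using pos rho_pos by (simp_all add: c_def)
  have conc: "2 / 3 \<le> prob {\<omega> \<in> space (corr_space \<rho>). \<bar>Z \<omega> - 12 * c * p\<bar> < c}"
    and [measurable]: "Z \<in> borel_measurable (corr_space \<rho>)"
    using sketch_concentration[OF assms(1,2)] unfolding p_def[symmetric] c_def[symmetric] c(2) Z_def .
  have out: "outputs \<pi> x y \<omega> v \<longleftrightarrow> (Z \<omega> \<ge> 6 * c) = v" for \<omega> v
    unfolding \<pi>_def outputs_sketch_protocol Z_def c(3) ..
  {
    assume "(\<Sum>d<D. a x d * b y d) \<ge> 7 / 12"
    then have "12 * c * p \<ge> 12 * c * (7 / 12)"
      unfolding p_def using c(1) by (intro mult_left_mono) auto
    then show "\<P>(\<omega> in corr_space \<rho>. outputs \<pi> x y \<omega> True) \<ge> 2 / 3"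
      unfolding out by (intro order_trans[OF conc] finite_measure_mono) auto
  next
    assume "(\<Sum>d<D. a x d * b y d) \<le> 5 / 12"
    then have "12 * c * p \<le> 12 * c * (5 / 12)"
      unfolding p_def using c(1) by (intro mult_left_mono) auto
    then show "\<P>(\<omega> in corr_space \<rho>. outputs \<pi> x y \<omega> False) \<ge> 2 / 3"
      unfolding out by (intro order_trans[OF conc] finite_measure_mono) auto
  }
qed

end

end

section \<open>Acceptance probabilities as inner products\<close>

lemma (in prob_space) gram_matrix_prob:
  fixes E :: "'i \<Rightarrow> 'a set"
  assumes "finite J" "\<And>i. i \<in> J \<Longrightarrow> E i \<in> events"
  shows "\<exists>v :: 'i \<Rightarrow> 'i set \<Rightarrow> real. \<forall>i\<in>J. \<forall>j\<in>J. (\<Sum>S\<in>Pow J. v i S * v j S) = prob (E i \<inter> E j)"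
proof (intro exI ballI)
  \<comment> \<open>Coordinates are indexed by the joint patterns of the events, weighted by their probability.\<close>
  let ?h = "\<lambda>S. {\<omega> \<in> space M. \<forall>i\<in>J. \<omega> \<in> E i \<longleftrightarrow> i \<in> S}"
  let ?v = "\<lambda>i S. if i \<in> S then sqrt (prob (?h S)) else 0"
  have ev: "?h S \<in> events" for S
    using assms by measurable
  fix i j assume ij: "i \<in> J" "j \<in> J"
  let ?P = "{S \<in> Pow J. i \<in> S \<and> j \<in> S}"
  have "(\<Sum>S\<in>Pow J. ?v i S * ?v j S) = (\<Sum>S\<in>Pow J. if i \<in> S \<and> j \<in> S then prob (?h S) else 0)"
    by (intro sum.cong) auto
  also have "\<dots> = (\<Sum>S\<in>?P. prob (?h S))"
    using assms(1) by (intro sum.inter_filter[symmetric]) simp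
  also have "\<dots> = prob (\<Union>S\<in>?P. ?h S)"
  proof (intro finite_measure_finite_Union[symmetric])
    show "finite ?P" using assms(1) by simp
    show "?h ` ?P \<subseteq> events" using ev by auto
    show "disjoint_family_on ?h ?P" unfolding disjoint_family_on_def by blast
  qed
  also have "(\<Union>S\<in>?P. ?h S) = E i \<inter> E j"
  proof (intro equalityI subsetI)
    fix \<omega> assume \<omega>: "\<omega> \<in> E i \<inter> E j"
    then have "\<omega> \<in> ?h {l \<in> J. \<omega> \<in> E l}"
      using assms(2)[OF ij(1)] sets.sets_into_space by auto
    with \<omega> ij show "\<omega> \<in> (\<Union>S\<in>?P. ?h S)"
      by (intro UN_I[of "{l \<in> J. \<omega> \<in> E l}"]) auto
  qed (use ij in auto)
  finally show "(\<Sum>S\<in>Pow J. ?v i S * ?v j S) = prob (E i \<inter> E j)" .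
qed

section \<open>Rectangle structure of transcripts\<close>

definition own_bit :: "protocol \<Rightarrow> party \<Rightarrow> bool list \<Rightarrow> (nat \<Rightarrow> bool \<times> bool) \<Rightarrow> bool list \<Rightarrow> bool" where
  "own_bit \<pi> p z \<omega> t = (case p of Alice \<Rightarrow> alice \<pi> z (fst \<circ> \<omega>) t | Bob \<Rightarrow> bob \<pi> z (snd \<circ> \<omega>) t)"

text \<open>Since \<open>act\<close> reads only the transcript, \<open>t\<close> itself fixes whose
  turn it is at each prefix. The condition therefore involves only the input and the signs of party
  \<open>p\<close>.\<close>

definition follows :: "protocol \<Rightarrow> party \<Rightarrow> bool list \<Rightarrow> (nat \<Rightarrow> bool \<times> bool) \<Rightarrow> bool list \<Rightarrow> bool" where
  "follows \<pi> p z \<omega> t \<longleftrightarrow>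
    (\<forall>i<length t. act \<pi> (take i t) = Send p \<longrightarrow> own_bit \<pi> p z \<omega> (take i t) = t ! i)"

text \<open>The events \<open>A\<^sub>t\<close> and \<open>B\<^sub>t\<close>: they also require the answer, if it is up to this party, to be
  \<^const>\<open>True\<close>.\<close>

definition consents :: "protocol \<Rightarrow> party \<Rightarrow> bool list \<Rightarrow> (nat \<Rightarrow> bool \<times> bool) \<Rightarrow> bool list \<Rightarrow> bool" where
  "consents \<pi> p z \<omega> t \<longleftrightarrow> follows \<pi> p z \<omega> t \<and> (act \<pi> t = Answer p \<longrightarrow> own_bit \<pi> p z \<omega> t)"

definition open_path :: "protocol \<Rightarrow> bool list \<Rightarrow> bool" where
  "open_path \<pi> t \<longleftrightarrow> (\<forall>i<length t. \<exists>p. act \<pi> (take i t) = Send p)"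

definition leaf :: "protocol \<Rightarrow> bool list \<Rightarrow> bool" where
  "leaf \<pi> t \<longleftrightarrow> open_path \<pi> t \<and> (\<exists>p. act \<pi> t = Answer p)"

text \<open>Stage \<open>length t\<close> is the canonical one: by
  \<open>transcript_length_transcript\<close>, a transcript occurring at any stage also occurs at
  the stage given by its length.\<close>

definition accepts :: "protocol \<Rightarrow> bool list \<Rightarrow> bool list \<Rightarrow> (nat \<Rightarrow> bool \<times> bool) \<Rightarrow> bool list \<Rightarrow> bool" where
  "accepts \<pi> x y \<omega> t \<longleftrightarrow>
    transcript \<pi> x y \<omega> (length t) = t \<and> (\<exists>p. act \<pi> t = Answer p \<and> party_bit \<pi> x y \<omega> p t)"

lemma length_transcript_le: "length (transcript \<pi> x y \<omega> j) \<le> j"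
  by (induction j) (auto simp: Let_def split: action.split)

lemma transcript_length_transcript:
  "transcript \<pi> x y \<omega> (length (transcript \<pi> x y \<omega> j)) = transcript \<pi> x y \<omega> j"
proof (induction j)
  case (Suc j)
  then show ?case
    by (cases "act \<pi> (transcript \<pi> x y \<omega> j)") (simp_all add: Let_def)
qed simp

text \<open>A transcript of length \<open>j\<close> after \<open>j\<close> stages received a bit at
  every stage, so the earlier transcripts are its prefixes.\<close>

lemma transcript_take:
  assumes "length (transcript \<pi> x y \<omega> j) = j" "i \<le> j"
  shows "transcript \<pi> x y \<omega> i = take i (transcript \<pi> x y \<omega> j)"
  using assms
proof (induction j)
  case (Suc j)
  then have "length (transcript \<pi> x y \<omega> j) = j"
    using length_transcript_le[of \<pi> x y \<omega> j] by (auto simp: Let_def split: action.splits)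
  with Suc show ?case
    by (cases "i = Suc j") (auto simp: Let_def split: action.splits)
qed simp

lemma transcript_stop:
  assumes "act \<pi> (transcript \<pi> x y \<omega> j) = Answer p"
  shows "transcript \<pi> x y \<omega> (j + i) = transcript \<pi> x y \<omega> j"
  using assms by (induction i) (simp_all add: Let_def)

lemma final_transcript_unique:
  assumes "act \<pi> (transcript \<pi> x y \<omega> i) = Answer p" "act \<pi> (transcript \<pi> x y \<omega> j) = Answer q"
  shows "transcript \<pi> x y \<omega> i = transcript \<pi> x y \<omega> j"
  using transcript_stop[OF assms(1), of "j - i"] transcript_stop[OF assms(2), of "i - j"]
  by (cases "i \<le> j") simp_all

text \<open>The rectangle property: producing \<open>t\<close> splits into a condition on
  \<open>t\<close> alone, one on Alice's data and one on Bob's. Both directions go prefix by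
  prefix.\<close>

lemma transcript_eq_iff:
  "transcript \<pi> x y \<omega> (length t) = t \<longleftrightarrow>
    open_path \<pi> t \<and> follows \<pi> Alice x \<omega> t \<and> follows \<pi> Bob y \<omega> t"
proof
  assume t: "transcript \<pi> x y \<omega> (length t) = t"
  then have pre: "transcript \<pi> x y \<omega> i = take i t" if "i \<le> length t" for i
    using transcript_take[of \<pi> x y \<omega> "length t" i] that by simp
  have "\<exists>p. act \<pi> (take i t) = Send p \<and> party_bit \<pi> x y \<omega> p (take i t) = t ! i"
    if "i < length t" for i
  proof -
    have "transcript \<pi> x y \<omega> (Suc i) = take i t @ [t ! i]"
      using pre[of "Suc i"] that by (simp add: take_Suc_conv_app_nth)
    then show ?thesis
      using pre[of i] that by (cases "act \<pi> (take i t)") (auto simp: Let_def)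
  qed
  then show "open_path \<pi> t \<and> follows \<pi> Alice x \<omega> t \<and> follows \<pi> Bob y \<omega> t"
    by (fastforce simp: open_path_def follows_def own_bit_def)
next
  assume *: "open_path \<pi> t \<and> follows \<pi> Alice x \<omega> t \<and> follows \<pi> Bob y \<omega> t"
  have "transcript \<pi> x y \<omega> i = take i t" if "i \<le> length t" for i
    using that
  proof (induction i)
    case (Suc i)
    then obtain p where p: "act \<pi> (take i t) = Send p"
      using * unfolding open_path_def by (meson Suc_le_lessD)
    then have "party_bit \<pi> x y \<omega> p (take i t) = t ! i"
      using * Suc.prems by (cases p) (auto simp: follows_def own_bit_def)
    with Suc p show ?case
      by (simp add: Let_def take_Suc_conv_app_nth)
  qed simp
  then show "transcript \<pi> x y \<omega> (length t) = t"
    by simp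
qed

lemma ex_party: "(\<exists>p. Q p) \<longleftrightarrow> Q Alice \<or> Q Bob"
  by (metis party.exhaust)

text \<open>The rectangle property extended by the answer: at a leaf exactly one party answers, and
  for the other one the implication in \<open>consents\<close> is vacuous.\<close>

lemma accepts_iff:
  "accepts \<pi> x y \<omega> t \<longleftrightarrow> leaf \<pi> t \<and> consents \<pi> Alice x \<omega> t \<and> consents \<pi> Bob y \<omega> t"
proof -
  have bits: "party_bit \<pi> x y \<omega> Alice t = own_bit \<pi> Alice x \<omega> t" "party_bit \<pi> x y \<omega> Bob t = own_bit \<pi> Bob y \<omega> t"
    by (simp_all add: own_bit_def)
  show ?thesis
    unfolding accepts_def transcript_eq_iff leaf_def consents_def ex_party bits by auto
qed

lemma accepts_unique: "accepts \<pi> x y \<omega> t \<Longrightarrow> accepts \<pi> x y \<omega> t' \<Longrightarrow> t = t'"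
  unfolding accepts_def using final_transcript_unique by metis

lemma outputs_True_iff: "outputs \<pi> x y \<omega> True \<longleftrightarrow> (\<exists>t. accepts \<pi> x y \<omega> t)"
  unfolding outputs_def accepts_def Let_def using transcript_length_transcript by metis

lemma outputs_unique: "outputs \<pi> x y \<omega> u \<Longrightarrow> outputs \<pi> x y \<omega> v \<Longrightarrow> u = v"
  unfolding outputs_def Let_def using final_transcript_unique by (metis action.inject(2))

section \<open>Measurability and truncated acceptance\<close>

lemma fst_snd_measurable:
  "(\<lambda>\<omega>. fst \<circ> \<omega>) \<in> measurable (corr_space \<rho>) bit_seq_space"
  "(\<lambda>\<omega>. snd \<circ> \<omega>) \<in> measurable (corr_space \<rho>) bit_seq_space"
  unfolding bit_seq_space_def comp_def
  by (auto intro!: measurable_PiM_single' corr_space_component_measurable)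

lemma own_bit_measurable:
  assumes "measurable_protocol \<pi>"
  shows "(\<lambda>\<omega>. own_bit \<pi> p z \<omega> t) \<in> measurable (corr_space \<rho>) (count_space UNIV)"
  using measurable_compose[OF fst_snd_measurable(1), of "\<lambda>r. alice \<pi> z r t"]
    measurable_compose[OF fst_snd_measurable(2), of "\<lambda>r. bob \<pi> z r t"] assms
  unfolding own_bit_def measurable_protocol_def by (cases p) simp_all

lemma
  assumes "measurable_protocol \<pi>"
  shows follows_event: "{\<omega> \<in> space (corr_space \<rho>). follows \<pi> p z \<omega> t} \<in> sets (corr_space \<rho>)"
    and consents_event: "{\<omega> \<in> space (corr_space \<rho>). consents \<pi> p z \<omega> t} \<in> sets (corr_space \<rho>)"
proof -
  note [measurable] = own_bit_measurable[OF assms]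
  show "{\<omega> \<in> space (corr_space \<rho>). follows \<pi> p z \<omega> t} \<in> sets (corr_space \<rho>)"
    "{\<omega> \<in> space (corr_space \<rho>). consents \<pi> p z \<omega> t} \<in> sets (corr_space \<rho>)"
    unfolding consents_def follows_def by measurable
qed

text \<open>The acceptance probability of the protocol cut off after \<open>T\<close> bits, where a
  run that is cut off counts as not accepting.\<close>

definition short_accept :: "real \<Rightarrow> protocol \<Rightarrow> nat \<Rightarrow> bool list \<Rightarrow> bool list \<Rightarrow> real" where
  "short_accept \<rho> \<pi> T x y = \<P>(\<omega> in corr_space \<rho>. \<exists>t. length t \<le> T \<and> accepts \<pi> x y \<omega> t)"

lemma finite_bool_lists_le: "finite {t :: bool list. length t \<le> n}"
  using finite_lists_length_le[of "UNIV :: bool set" n] by simp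

lemma card_bool_lists_le: "card {t :: bool list. length t \<le> n} \<le> 2 ^ Suc n"
proof -
  have "card {t :: bool list. length t \<le> n} = (\<Sum>i\<le>n. 2 ^ i)"
    using card_lists_length_le[of "UNIV :: bool set" n] by simp
  also have "\<dots> = 2 ^ Suc n - 1"
    using sum_power2[of "Suc n"] by (simp add: atLeast0LessThan lessThan_Suc_atMost)
  finally show ?thesis by simp
qed

text \<open>The acceptance event is a finite union over leaves, and it is disjoint because a run
  accepts at one transcript only.\<close>

lemma short_accept_eq:
  assumes "measurable_protocol \<pi>"
  shows "{\<omega> \<in> space (corr_space \<rho>). \<exists>t. length t \<le> T \<and> accepts \<pi> x y \<omega> t} \<in> sets (corr_space \<rho>)" (is ?ev)
    and "short_accept \<rho> \<pi> T x y = (\<Sum>t | length t \<le> T \<and> leaf \<pi> t.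
      measure (corr_space \<rho>) ({\<omega> \<in> space (corr_space \<rho>). consents \<pi> Alice x \<omega> t} \<inter>
        {\<omega> \<in> space (corr_space \<rho>). consents \<pi> Bob y \<omega> t}))" (is ?eq)
proof -
  interpret prob_space "corr_space \<rho>" by (rule prob_space_corr_space)
  let ?V = "{t. length t \<le> T \<and> leaf \<pi> t}"
  let ?C = "\<lambda>t. {\<omega> \<in> space (corr_space \<rho>). consents \<pi> Alice x \<omega> t} \<inter>
        {\<omega> \<in> space (corr_space \<rho>). consents \<pi> Bob y \<omega> t}"
  have fin: "finite ?V"
    by (rule finite_subset[OF _ finite_bool_lists_le]) auto
  have ev: "?C t \<in> events" for t
    using consents_event[OF assms] by blast
  have eq: "{\<omega> \<in> space (corr_space \<rho>). \<exists>t. length t \<le> T \<and> accepts \<pi> x y \<omega> t} = (\<Union>t\<in>?V. ?C t)"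
    by (auto simp: accepts_iff)
  show ?ev
    unfolding eq using fin ev by blast
  have "disjoint_family_on ?C ?V"
    unfolding disjoint_family_on_def using accepts_unique by (fastforce simp: accepts_iff)
  then show ?eq
    unfolding short_accept_def eq using fin ev by (intro finite_measure_finite_Union) auto
qed

text \<open>For each leaf \<open>t\<close>, \<open>gram_matrix_prob\<close> turns the events of
  \<open>consents\<close> into vectors; concatenating them over all leaves gives the sum in
  \<open>short_accept_eq\<close>. Each leaf adds a probability, so at most 1, to a squared norm, and
  there are at most \<open>2 ^ Suc T\<close> leaves. The bijection \<open>h\<close> only renumbers
  the coordinates.\<close>

lemma short_accept_gram:
  assumes \<pi>: "measurable_protocol \<pi>" and X: "finite X"
  shows "\<exists>(D::nat) a b. (\<forall>x\<in>X. (\<Sum>d<D. (a x d)\<^sup>2) \<le> 2 ^ Suc T) \<and> (\<forall>y\<in>X. (\<Sum>d<D. (b y d)\<^sup>2) \<le> 2 ^ Suc T) \<and>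
    (\<forall>x\<in>X. \<forall>y\<in>X. (\<Sum>d<D. a x d * b y d) = short_accept \<rho> \<pi> T x y)"
proof -
  interpret prob_space "corr_space \<rho>" by (rule prob_space_corr_space)
  define V where "V = {t. length t \<le> T \<and> leaf \<pi> t}"
  \<comment> \<open>Both parties and all inputs share one Gram representation, so that the vector
    for \<open>x\<close> does not depend on \<open>y\<close>, nor conversely.\<close>
  define J where "J = {Alice, Bob} \<times> X \<times> V"
  define E where "E = (\<lambda>(p, z, t). {\<omega> \<in> space (corr_space \<rho>). consents \<pi> p z \<omega> t})"
  have sub: "V \<subseteq> {t. length t \<le> T}"
    by (auto simp: V_def)
  have V: "finite V" "card V \<le> 2 ^ Suc T"
    by (rule finite_subset[OF sub finite_bool_lists_le])
       (rule order_trans[OF card_mono[OF finite_bool_lists_le sub] card_bool_lists_le])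
  have J: "finite J"
    using V X by (simp add: J_def)
  have E: "E i \<in> events" for i
    using consents_event[OF \<pi>] by (auto simp: E_def split: prod.split)
  obtain v where v: "\<forall>i\<in>J. \<forall>j\<in>J. (\<Sum>S\<in>Pow J. v i S * v j S) = prob (E i \<inter> E j)"
    using gram_matrix_prob[of J E, OF J E] by blast
  have "finite (Pow J \<times> V)"
    using J V by simp
  then obtain h where h: "bij_betw h {0..<card (Pow J \<times> V)} (Pow J \<times> V)"
    using ex_bij_betw_nat_finite by blast
  define w where "w = (\<lambda>p z d. case h d of (S, t) \<Rightarrow> v (p, z, t) S)"
  have inner: "(\<Sum>d<card (Pow J \<times> V). w p z d * w p' z' d) = (\<Sum>t\<in>V. prob (E (p, z, t) \<inter> E (p', z', t)))"
    if "p \<in> {Alice, Bob}" "p' \<in> {Alice, Bob}" "z \<in> X" "z' \<in> X" for p p' z z'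
  proof -
    have "(\<Sum>d<card (Pow J \<times> V). w p z d * w p' z' d) =
        (\<Sum>(S, t)\<in>Pow J \<times> V. v (p, z, t) S * v (p', z', t) S)"
      using sum.reindex_bij_betw[OF h, of "\<lambda>(S, t). v (p, z, t) S * v (p', z', t) S"]
      by (simp add: w_def case_prod_unfold atLeast0LessThan)
    also have "\<dots> = (\<Sum>t\<in>V. \<Sum>S\<in>Pow J. v (p, z, t) S * v (p', z', t) S)"
      by (subst sum.cartesian_product[symmetric], rule sum.swap)
    also have "\<dots> = (\<Sum>t\<in>V. prob (E (p, z, t) \<inter> E (p', z', t)))"
      using that by (intro sum.cong refl bspec[OF bspec[OF v]]) (auto simp: J_def)
    finally show ?thesis .
  qed
  have norm: "(\<Sum>d<card (Pow J \<times> V). (w p z d)\<^sup>2) \<le> 2 ^ Suc T" if "p \<in> {Alice, Bob}" "z \<in> X" for p z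
  proof -
    have "(\<Sum>d<card (Pow J \<times> V). (w p z d)\<^sup>2) \<le> of_nat (card V) * 1"
      unfolding power2_eq_square inner[OF that(1) that(1) that(2) that(2)] by (rule sum_bounded_above) simp
    also have "\<dots> \<le> 2 ^ Suc T"
      using V(2) by (metis mult.right_neutral of_nat_le_iff of_nat_numeral of_nat_power)
    finally show ?thesis .
  qed
  have "(\<Sum>d<card (Pow J \<times> V). w Alice x d * w Bob y d) = short_accept \<rho> \<pi> T x y"
    if "x \<in> X" "y \<in> X" for x y
    using inner[of Alice Bob x y] that unfolding short_accept_eq(2)[OF \<pi>] V_def E_def by simp
  with norm show ?thesis
    by (intro exI[of _ "card (Pow J \<times> V)"] exI[of _ "w Alice"] exI[of _ "w Bob"]) simp
qed

text \<open>Markov's inequality: a run that accepts after more than \<open>T\<close> bits lies in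
  \<open>?L\<close>, the event that at least \<open>Suc T\<close> bits are sent, and the cost bound
  makes \<open>?L\<close> unlikely.\<close>

lemma accept_le_short_accept:
  assumes \<pi>: "measurable_protocol \<pi>"
    and cost: "(\<integral>\<^sup>+\<omega>. bits_sent \<pi> x y \<omega> \<partial>corr_space \<rho>) \<le> ennreal k" and "k \<ge> 0"
  shows "\<P>(\<omega> in corr_space \<rho>. outputs \<pi> x y \<omega> True) \<le> short_accept \<rho> \<pi> T x y + k / Suc T"
proof -
  interpret prob_space "corr_space \<rho>" by (rule prob_space_corr_space)
  let ?A = "{\<omega> \<in> space (corr_space \<rho>). \<exists>t. length t \<le> T \<and> accepts \<pi> x y \<omega> t}"
  let ?L = "{\<omega> \<in> space (corr_space \<rho>). length (transcript \<pi> x y \<omega> (Suc T)) = Suc T}"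
  have A: "?A \<in> events"
    by (rule short_accept_eq[OF \<pi>])
  \<comment> \<open>Measurability of \<open>?L\<close>: by \<open>transcript_eq_iff\<close> it is a
    countable union of intersections of \<open>follows\<close> events.\<close>
  have "length (transcript \<pi> x y \<omega> (Suc T)) = Suc T \<longleftrightarrow>
      (\<exists>t. length t = Suc T \<and> transcript \<pi> x y \<omega> (length t) = t)" for \<omega>
    by (metis (no_types))
  then have "?L = (\<Union>t\<in>{t. length t = Suc T \<and> open_path \<pi> t}.
      {\<omega> \<in> space (corr_space \<rho>). follows \<pi> Alice x \<omega> t} \<inter> {\<omega> \<in> space (corr_space \<rho>). follows \<pi> Bob y \<omega> t})"
    (is "_ = (\<Union>t\<in>_. ?F t)")
    unfolding transcript_eq_iff by blast
  moreover have "?F t \<in> events" for t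
    using follows_event[OF \<pi>] by blast
  ultimately have L: "?L \<in> events"
    using countable_subset[OF subset_UNIV countableI_type] by (auto intro!: sets.countable_UN')
  have "ennreal (Suc T * prob ?L) = (\<integral>\<^sup>+\<omega>. ennreal (Suc T) * indicator ?L \<omega> \<partial>corr_space \<rho>)"
    using L by (subst nn_integral_cmult_indicator) (simp_all add: emeasure_eq_measure ennreal_mult del: of_nat_Suc transcript.simps)
  also have "\<dots> \<le> (\<integral>\<^sup>+\<omega>. bits_sent \<pi> x y \<omega> \<partial>corr_space \<rho>)"
  proof (rule nn_integral_mono)
    fix \<omega>
    have "of_nat (length (transcript \<pi> x y \<omega> (Suc T))) \<le> bits_sent \<pi> x y \<omega>"
      unfolding bits_sent_def by (rule SUP_upper[OF UNIV_I])
    then show "ennreal (Suc T) * indicator ?L \<omega> \<le> bits_sent \<pi> x y \<omega>"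
      by (auto simp: indicator_def ennreal_of_nat_eq_real_of_nat simp del: of_nat_Suc transcript.simps)
  qed
  finally have "Suc T * prob ?L \<le> k"
    using cost \<open>k \<ge> 0\<close> by (meson ennreal_le_iff order_trans)
  then have L_le: "prob ?L \<le> k / Suc T"
    by (simp add: field_simps del: of_nat_Suc transcript.simps)
  have "\<P>(\<omega> in corr_space \<rho>. outputs \<pi> x y \<omega> True) \<le> prob (?A \<union> ?L)"
  proof (rule finite_measure_mono)
    show "{\<omega> \<in> space (corr_space \<rho>). outputs \<pi> x y \<omega> True} \<subseteq> ?A \<union> ?L"
    proof
      fix \<omega> assume \<omega>: "\<omega> \<in> {\<omega> \<in> space (corr_space \<rho>). outputs \<pi> x y \<omega> True}"
      then obtain t where t: "accepts \<pi> x y \<omega> t"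
        by (auto simp: outputs_True_iff)
      then have "length (transcript \<pi> x y \<omega> (Suc T)) = Suc T" if "length t > T"
        using that transcript_take[of \<pi> x y \<omega> "length t" "Suc T"] by (simp add: accepts_def del: transcript.simps)
      with t \<omega> show "\<omega> \<in> ?A \<union> ?L"
        by (cases "length t \<le> T") (auto simp del: transcript.simps)
    qed
  qed (rule sets.Un[OF A L])
  also have "\<dots> \<le> prob ?A + prob ?L"
    by (rule measure_Un_le[OF A L])
  finally show ?thesis
    using L_le unfolding short_accept_def by linarith
qed

text \<open>A run has at most one output, so accepting excludes the output \<open>False\<close>.
  Truncation can only lower acceptance, hence nothing is lost on this side.\<close>

lemma short_accept_le:
  assumes \<pi>: "measurable_protocol \<pi>"
    and out: "\<P>(\<omega> in corr_space \<rho>. outputs \<pi> x y \<omega> False) \<ge> q" and "q > 0"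
  shows "short_accept \<rho> \<pi> T x y \<le> 1 - q"
proof -
  interpret prob_space "corr_space \<rho>" by (rule prob_space_corr_space)
  let ?O = "{\<omega> \<in> space (corr_space \<rho>). outputs \<pi> x y \<omega> False}"
  \<comment> \<open>A non-measurable set would have measure \<open>0\<close>.\<close>
  have ev: "?O \<in> events"
    using out \<open>q > 0\<close> measure_notin_sets by fastforce
  have "short_accept \<rho> \<pi> T x y \<le> prob (space (corr_space \<rho>) - ?O)"
    unfolding short_accept_def
    using outputs_unique[of \<pi> x y _ True False] ev
    by (intro finite_measure_mono) (auto simp: outputs_True_iff)
  also have "\<dots> = 1 - prob ?O"
    by (rule prob_compl[OF ev])
  finally show ?thesis
    using out by simp
qed

section \<open>Choice of parameters and the final bound\<close>

text \<open>The correlation \<sigma> of the given protocol is absorbed into the vectors of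
  \<open>short_accept_gram\<close>, while \<rho> governs the sketch of their inner product.
  \<open>R\<close> is an integer bound for 1 / \<rho> that keeps all parameters natural numbers. The
  message length is \<open>m * (2 * K)\<close>.\<close>

lemma (in correlation) one_way_simulation:
  fixes k n R :: nat
  assumes \<pi>: "measurable_protocol \<pi>" and k: "k > 0" and R: "R * \<rho> \<ge> 1"
    and cost: "\<And>x y. x \<in> cube n \<Longrightarrow> y \<in> cube n \<Longrightarrow>
      (\<integral>\<^sup>+\<omega>. bits_sent \<pi> x y \<omega> \<partial>corr_space \<sigma>) \<le> ennreal k"
  obtains \<pi>' where "measurable_protocol \<pi>'" "one_way \<pi>'"
    and "\<And>x y \<omega>. bits_sent \<pi>' x y \<omega> = of_nat (27648 * 48 ^ 4 * (2 ^ Suc (12 * k)) ^ 8 * R ^ 6)"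
    and "\<And>x y. x \<in> cube n \<Longrightarrow> y \<in> cube n \<Longrightarrow>
      \<P>(\<omega> in corr_space \<sigma>. outputs \<pi> x y \<omega> True) \<ge> 2 / 3 \<Longrightarrow> \<P>(\<omega> in corr_space \<rho>. outputs \<pi>' x y \<omega> True) \<ge> 2 / 3"
    and "\<And>x y. x \<in> cube n \<Longrightarrow> y \<in> cube n \<Longrightarrow>
      \<P>(\<omega> in corr_space \<sigma>. outputs \<pi> x y \<omega> False) \<ge> 2 / 3 \<Longrightarrow> \<P>(\<omega> in corr_space \<rho>. outputs \<pi>' x y \<omega> False) \<ge> 2 / 3"
proof -
  \<comment> \<open>\<open>s\<close> is chosen so that the signal \<open>s \<rho>\<close> dominates the rounding error, \<open>K\<close> so that clamping
    is negligible, and \<open>m\<close> so that the fluctuation is.\<close>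
  define N where "N = (2::nat) ^ Suc (12 * k)"
  define s where "s = 48 * N * R"
  define K where "K = 2 * s\<^sup>2 * N"
  define m where "m = 6912 * s\<^sup>2 * N ^ 3 * R\<^sup>2"
  have N: "real N = 2 ^ Suc (12 * k)" "N \<ge> 1"
    by (auto simp: N_def)
  have "R > 0"
    using R by (cases R) auto
  then have pos: "K > 0" "m > 0" "real s > 0"
    using N by (auto simp: s_def K_def m_def)
  \<comment> \<open>With \<open>K = 2 * s\<^sup>2 * N\<close> the clamping term is exactly 3/4, so
    the left side is at most \<open>2 * N\<close>, and \<open>s\<close> was chosen to make the right
    side at least that.\<close>
  have bias: "(1 + 3 * real s ^ 4 * (real N)\<^sup>2 / (real K)\<^sup>2 + real N) / 2 \<le> real s * \<rho> / 24"
  proof -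
    have "(real K)\<^sup>2 = 4 * (real s ^ 4 * (real N)\<^sup>2)"
      unfolding K_def of_nat_mult of_nat_power of_nat_numeral by algebra
    then have "3 * real s ^ 4 * (real N)\<^sup>2 / (real K)\<^sup>2 = 3 / 4"
      using pos(3) N by simp
    moreover have "48 * real N \<le> real s * \<rho>"
      using mult_left_mono[OF R, of "48 * real N"] by (simp add: s_def mult.assoc)
    ultimately show ?thesis
      using N(2) by simp
  qed
  \<comment> \<open>Both sides are \<open>6912 * s ^ 4 * N ^ 3\<close> up to the factor
    \<open>(R * \<rho>)\<^sup>2\<close>, which is at least 1.\<close>
  have spread: "1728 * ((real K)\<^sup>2 * real N) \<le> real m * (real s * \<rho>)\<^sup>2"
  proof -
    have "1728 * ((real K)\<^sup>2 * real N) = 6912 * real s ^ 4 * real N ^ 3 * 1"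
      unfolding K_def of_nat_mult of_nat_power of_nat_numeral by algebra
    also have "\<dots> \<le> 6912 * real s ^ 4 * real N ^ 3 * (R * \<rho>)\<^sup>2"
      using R by (intro mult_left_mono) auto
    also have "\<dots> = real m * (real s * \<rho>)\<^sup>2"
      unfolding m_def of_nat_mult of_nat_power of_nat_numeral by algebra
    finally show ?thesis .
  qed
  have fin: "finite (cube n)"
    unfolding cube_def by (rule finite_subset[OF _ finite_bool_lists_le[of n]]) auto
  obtain D :: nat and a b :: "bool list \<Rightarrow> nat \<Rightarrow> real"
    where ab: "\<And>x. x \<in> cube n \<Longrightarrow> (\<Sum>d<D. (a x d)\<^sup>2) \<le> real N"
      "\<And>y. y \<in> cube n \<Longrightarrow> (\<Sum>d<D. (b y d)\<^sup>2) \<le> real N"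
      "\<And>x y. x \<in> cube n \<Longrightarrow> y \<in> cube n \<Longrightarrow> (\<Sum>d<D. a x d * b y d) = short_accept \<sigma> \<pi> (12 * k) x y"
    using short_accept_gram[OF \<pi> fin, of "12 * k" \<sigma>, folded N(1)] by blast
  note correct = sketch_protocol_correct[OF pos bias spread, where D = D and a = a and b = b]
  let ?\<pi> = "sketch_protocol D a b K (real s) m (m * (real s * \<rho> / 2))"
  show ?thesis
  proof
    show "measurable_protocol ?\<pi>" "one_way ?\<pi>"
      by (rule measurable_sketch_protocol one_way_sketch_protocol)+
    have len: "m * (2 * K) = 27648 * 48 ^ 4 * N ^ 8 * R ^ 6"
      unfolding m_def K_def s_def by algebra
    show "bits_sent ?\<pi> x y \<omega> = of_nat (27648 * 48 ^ 4 * (2 ^ Suc (12 * k)) ^ 8 * R ^ 6)" for x y \<omega>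
      unfolding bits_sent_sketch_protocol len N_def ..
    fix x y assume xy: "x \<in> cube n" "y \<in> cube n"
    show "\<P>(\<omega> in corr_space \<rho>. outputs ?\<pi> x y \<omega> True) \<ge> 2 / 3"
      if "\<P>(\<omega> in corr_space \<sigma>. outputs \<pi> x y \<omega> True) \<ge> 2 / 3"
    proof (rule correct(1)[OF ab(1)[OF xy(1)] ab(2)[OF xy(2)]])
      \<comment> \<open>Truncation after \<open>12 * k\<close> bits costs at most 1/12, and 2/3 -
        1/12 = 7/12.\<close>
      have "real k / Suc (12 * k) \<le> 1 / 12"
        by (simp add: field_simps)
      then show "7 / 12 \<le> (\<Sum>d<D. a x d * b y d)"
        unfolding ab(3)[OF xy]
        using that accept_le_short_accept[OF \<pi> cost[OF xy] of_nat_0_le_iff, of "12 * k"] by linarith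
    qed
    \<comment> \<open>Here acceptance is at most 1 - 2/3, which is below 5/12.\<close>
    show "\<P>(\<omega> in corr_space \<rho>. outputs ?\<pi> x y \<omega> False) \<ge> 2 / 3"
      if "\<P>(\<omega> in corr_space \<sigma>. outputs \<pi> x y \<omega> False) \<ge> 2 / 3"
      using short_accept_le[OF \<pi> that, of "12 * k"] ab(3)[OF xy]
      by (intro correct(2)[OF ab(1)[OF xy(1)] ab(2)[OF xy(2)]]) simp
  qed
qed

theorem theorem2p8:
  fixes \<rho> :: real
  assumes "0 < \<rho>" and "\<rho> \<le> 1"
  shows "\<exists>c::real. \<forall>k::nat. k > 0 \<longrightarrow> PSR_CC (real k) \<subseteq> ISR_CC_one_way \<rho> (c ^ k)"
proof -
  interpret correlation \<rho>
    using assms by unfold_locales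
  obtain R :: nat where R: "R * \<rho> \<ge> 1"
    using ex_less_of_nat_mult[OF assms(1), of 1] by (auto intro: less_imp_le)
  define C where "C = 27648 * 48 ^ 4 * R ^ 6"
  have "R > 0"
    using R by (cases R) auto
  then have C: "C \<ge> 1"
    by (simp add: C_def)
  have "PSR_CC (real k) \<subseteq> ISR_CC_one_way \<rho> (real (C * 2 ^ 104) ^ k)" if k: "k > 0" for k
  proof
    fix P assume "P \<in> PSR_CC (real k)"
    then obtain \<Phi> where P: "is_promise_problem P" and \<Phi>: "\<And>n. measurable_protocol (\<Phi> n)"
      and solves: "solves 1 \<Phi> P" and cost: "cost 1 \<Phi> \<le> ennreal k"
      by (auto simp: PSR_CC_def ISR_CC_def)
    have bits: "(\<integral>\<^sup>+\<omega>. bits_sent (\<Phi> n) x y \<omega> \<partial>corr_space 1) \<le> ennreal k"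
      if "x \<in> cube n" "y \<in> cube n" for n x y
    proof -
      have "(\<integral>\<^sup>+\<omega>. bits_sent (\<Phi> n) x y \<omega> \<partial>corr_space 1) \<le> cost 1 \<Phi>"
        unfolding cost_def using that by (intro SUP_upper2[of n] SUP_upper2[of "(x, y)"]) auto
      with cost show ?thesis by simp
    qed
    let ?B = "27648 * 48 ^ 4 * (2 ^ Suc (12 * k)) ^ 8 * R ^ 6"
    \<comment> \<open>All properties needed for input length \<open>n\<close> in one predicate, so
      that a single choice of a protocol for every \<open>n\<close> yields the family
      \<Psi>.\<close>
    define good where "good n \<pi>' \<longleftrightarrow> measurable_protocol \<pi>' \<and> one_way \<pi>' \<and>
        (\<forall>x y \<omega>. bits_sent \<pi>' x y \<omega> = of_nat ?B) \<and>
        (\<forall>x\<in>cube n. \<forall>y\<in>cube n. \<forall>v. \<P>(\<omega> in corr_space 1. outputs (\<Phi> n) x y \<omega> v) \<ge> 2 / 3 \<longrightarrow>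
          \<P>(\<omega> in corr_space \<rho>. outputs \<pi>' x y \<omega> v) \<ge> 2 / 3)" for n \<pi>'
    have "\<exists>\<pi>'. good n \<pi>'" for n
    proof (rule one_way_simulation[OF \<Phi>[of n] k R bits])
      fix \<pi>' assume "measurable_protocol \<pi>'" "one_way \<pi>'" "\<And>x y \<omega>. bits_sent \<pi>' x y \<omega> = of_nat ?B"
        and out: "\<And>x y. x \<in> cube n \<Longrightarrow> y \<in> cube n \<Longrightarrow> \<P>(\<omega> in corr_space 1. outputs (\<Phi> n) x y \<omega> True) \<ge> 2 / 3 \<Longrightarrow>
            \<P>(\<omega> in corr_space \<rho>. outputs \<pi>' x y \<omega> True) \<ge> 2 / 3"
          "\<And>x y. x \<in> cube n \<Longrightarrow> y \<in> cube n \<Longrightarrow> \<P>(\<omega> in corr_space 1. outputs (\<Phi> n) x y \<omega> False) \<ge> 2 / 3 \<Longrightarrow>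
            \<P>(\<omega> in corr_space \<rho>. outputs \<pi>' x y \<omega> False) \<ge> 2 / 3"
      moreover have "\<P>(\<omega> in corr_space \<rho>. outputs \<pi>' x y \<omega> v) \<ge> 2 / 3"
        if "x \<in> cube n" "y \<in> cube n" "\<P>(\<omega> in corr_space 1. outputs (\<Phi> n) x y \<omega> v) \<ge> 2 / 3" for x y v
        using out that by (cases v) simp_all
      ultimately have "good n \<pi>'"
        unfolding good_def by blast
      then show ?thesis ..
    qed
    then obtain \<Psi> where "\<And>n. good n (\<Psi> n)"
      by metis
    then have \<Psi>: "\<And>n. measurable_protocol (\<Psi> n)" "\<And>n. one_way (\<Psi> n)"
      "\<And>n x y \<omega>. bits_sent (\<Psi> n) x y \<omega> = of_nat ?B"
      "\<And>n x y v. x \<in> cube n \<Longrightarrow> y \<in> cube n \<Longrightarrow> \<P>(\<omega> in corr_space 1. outputs (\<Phi> n) x y \<omega> v) \<ge> 2 / 3 \<Longrightarrow>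
          \<P>(\<omega> in corr_space \<rho>. outputs (\<Psi> n) x y \<omega> v) \<ge> 2 / 3"
      unfolding good_def by blast+
    have "solves \<rho> \<Psi> P"
      unfolding solves_def
    proof (intro conjI allI ballI)
      fix n and z assume z: "z \<in> yes_inst P n"
      then obtain x y where "z = (x, y)" "x \<in> cube n" "y \<in> cube n"
        using P by (cases z) (auto simp: is_promise_problem_def)
      then show "case z of (x, y) \<Rightarrow> \<P>(\<omega> in corr_space \<rho>. outputs (\<Psi> n) x y \<omega> True) \<ge> 2 / 3"
        using bspec[OF spec[OF conjunct1[OF solves[unfolded solves_def]]] z] \<Psi>(4)[of x n y True] by simp
    next
      fix n and z assume z: "z \<in> no_inst P n"
      then obtain x y where "z = (x, y)" "x \<in> cube n" "y \<in> cube n"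
        using P by (cases z) (auto simp: is_promise_problem_def)
      then show "case z of (x, y) \<Rightarrow> \<P>(\<omega> in corr_space \<rho>. outputs (\<Psi> n) x y \<omega> False) \<ge> 2 / 3"
        using bspec[OF spec[OF conjunct2[OF solves[unfolded solves_def]]] z] \<Psi>(4)[of x n y False] by simp
    qed
    moreover have "cost \<rho> \<Psi> \<le> ennreal (real (C * 2 ^ 104) ^ k)"
    proof -
      \<comment> \<open>The exponent 8 * (12 k + 1) = 96 k + 8 is at most 104 k because k is
        positive. The constant \<open>C\<close> depends on \<rho> only, through \<open>R\<close>,
        and is at most \<open>C ^ k\<close>.\<close>
      have "?B = C * 2 ^ (96 * k + 8)"
        by (simp add: C_def power_mult[symmetric] power_add)
      also have "\<dots> \<le> C ^ k * 2 ^ (104 * k)"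
        using C k by (intro mult_mono power_increasing self_le_power) auto
      also have "\<dots> = (C * 2 ^ 104) ^ k"
        by (simp only: power_mult power_mult_distrib)
      finally have "real ?B \<le> real (C * 2 ^ 104) ^ k"
        by (metis of_nat_le_iff of_nat_power)
      then have "of_nat ?B \<le> ennreal (real (C * 2 ^ 104) ^ k)"
        unfolding ennreal_of_nat_eq_real_of_nat by (rule ennreal_leI)
      then show ?thesis
        unfolding cost_def \<Psi>(3) by (auto intro!: SUP_least simp: emeasure_space_1)
    qed
    ultimately show "P \<in> ISR_CC_one_way \<rho> (real (C * 2 ^ 104) ^ k)"
      using P \<Psi>(1,2) by (auto simp: ISR_CC_one_way_def)
  qed
  then show ?thesis by blast
qed

end
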